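(* Consider the constrained convex program and its standing assumptions (i)–(iv) described in the context, and assume further that: (a) $h=\mathrm{Ind}_{\mathcal{C}}$ where $\mathcal{C}$ is compact and $(\nu,q)$-uniformly convex for some $q\ge 2$ and $\nu>0$; (b) for some $\epsilon>0$, $\inf\{\|\nabla f(x)+\sum_{i=1}^m z_i\nabla g_i(x)\| : (x,z)\in\mathcal{A}_\epsilon,\ x\in\mathcal{C}\}>0$, with $\mathcal{A}_\epsilon$ as defined in the context. Let $\{(x^k,z^k)\}$ be generated by the algorithm described in the context with parameters satisfying: $\{\lambda_k\}$ positive and increasing, $\lambda_k=\Theta(k^{\tau})$ and $\lambda_{k+1}-\lambda_k=\mathcal{O}(k^{-(1-\tau)})$ for some $\tau\in(0,1)$; for every $k$, $\alpha_k$ is the short stepsize (defined in the context) at $(x^k,z^k,v^k,\lambda_k)$; $\{\sigma_k\}$ positive with $\sigma_k\le\lambda_k$ and $\sigma_k=\Theta(k^{-(1+\gamma)})$ for some $\gamma>0$. Let $L^*$ be the optimal value of the program and $\mu:=1-2/q\in[0,1)$. Then $$\max\{|f(x^k)+h(x^k)-L^*|,\ \|[g(x^k)]_+\|\}=\mathcal{O}\Big(\max\Big\{\frac{1}{k^{\frac{1}{1+\mu}}},\frac{1}{k^{\frac{2-2\tau}{1+\mu}}},\frac{1}{k^{\tau}}\Big\}\Big).$$ In particular, when $q=2$ (so $\mu=0$, i.e. $\mathcal{C}$ is strongly convex), choosing $\tau=2/3$ gives the rate $\mathcal{O}(1/k^{2/3})$.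
   Context: Conventions: $\|\cdot\|$ is the Euclidean norm, vector inequalities and maxima are componentwise, $[a]_+=\max\{a,0\}$ (componentwise for vectors), $\mathrm{dom}\,h=\{x:h(x)<\infty\}$, $\mathrm{Ind}_{\mathcal{C}}$ is the indicator function ($0$ on $\mathcal{C}$, $+\infty$ elsewhere). Asymptotic notation is as $k\to\infty$. Problem: $\min_{x\in\mathbb{R}^n} f(x)+h(x)$ subject to $g(x):=(g_1(x),\dots,g_m(x))^T\le 0$. Standing assumptions: (i) $f:\mathbb{R}^n\to\mathbb{R}$ is convex and differentiable with $L_f$-Lipschitz gradient, $L_f>0$. (ii) $h:\mathbb{R}^n\to(-\infty,+\infty]$ is proper, closed, convex, $\sup_{x,x'\in\mathrm{dom}\,h}\|x-x'\|\le D$ for some finite $D>0$, and for every $u\in\mathbb{R}^n$ the problem $\min_v\langle v,u\rangle+h(v)$ has a minimizer. (iii) Each $g_i:\mathbb{R}^n\to\mathbb{R}$ is convex and differentiable, and there is $L_{g_i}>0$ with $\|\nabla g_i(x)-\nabla g_i(x')\|\le L_{g_i}\|x-x'\|$ for all $x,x'\in\mathrm{dom}\,h$. (iv) There is a KKT point $(x^*,z^* )$: $0\in\nabla f(x^* )+\partial h(x^* )+\sum_{i=1}^m z_i^*\nabla g_i(x^* )$, $g(x^* )\le 0$, $z^*\ge 0$, $\langle z^*,g(x^* )\rangle=0$. Fix constants $B_i>0$ with $\|\nabla g_i(x)\|\le B_i$ and $|g_i(x)-g_i(x')|\le B_i\|x-x'\|$ for all $x,x'\in\mathrm{dom}\,h$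 (these exist under the assumptions). Uniform convexity: a convex set $\mathcal{D}\subseteq\mathbb{R}^n$ is $(\nu,q)$-uniformly convex ($q\ge2$, $\nu>0$) if for all $x,y\in\mathcal{D}$, $t\in[0,1]$ and $w\in\mathbb{R}^n$ with $\|w\|=1$, one has $tx+(1-t)y+t(1-t)\nu\|x-y\|^q w\in\mathcal{D}$; it is called strongly convex when $q=2$. For $\epsilon>0$: $\mathcal{A}_\epsilon=\{(x,z)\in\mathbb{R}^n\times\mathbb{R}^m_+ : g_i(x)\le\epsilon\ \forall i,\text{ and for every } i,\ g_i(x)<-\epsilon\text{ implies } z_i=0\}$. For $\lambda>0$, let $\Psi_\lambda(x,z)=\frac{\lambda}{2}\sum_{i=1}^m\big([g_i(x)+z_i/\lambda]_+^2-(z_i/\lambda)^2\big)$ and $F_\lambda(x,z)=f(x)+\Psi_\lambda(x,z)$. Let $L_\Psi(x,z)=\sum_{i=1}^m(\lambda B_i^2+L_{g_i}[\lambda g_i(x)+z_i]_+)$ (depending on $\lambda$; $L_\Psi(x^k,z^k)$ is taken with $\lambda=\lambda_k$). Gap function: $G_{z,\lambda}(x)=\langle\nabla_xF_\lambda(x,z),x-v^+\rangle+h(x)-h(v^+)$ for any $v^+\in\mathrm{Argmin}_v\langle\nabla_xF_\lambda(x,z),v\rangle+h(v)$ (independent of the choice). Short stepsize at $(x,z,v^+,\lambda)$: it equals $0$ if $G_{z,\lambda}(x)=\|v^+-x\|=0$, and $\min\big\{1,\frac{G_{z,\lambda}(x)}{(L_\Psi(x,z)+L_f)\|v^+-x\|^2}\big\}$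 otherwise. Algorithm: choose $(x^0,z^0)\in\mathrm{dom}\,h\times\mathbb{R}^m_+$, a positive increasing sequence $\{\lambda_k\}$ ($\lambda_{k+1}>\lambda_k>0$) with $\lambda_k\to\infty$, a positive summable sequence $\{\sigma_k\}$ with $\sigma_k\le\lambda_k$, and stepsizes $\alpha_k\in[0,1]$. For $k=0,1,2,\dots$: $v^k\in\mathrm{Argmin}_{v}\ \langle\nabla_xF_{\lambda_k}(x^k,z^k),v\rangle+h(v)$ (any minimizer); $x^{k+1}=x^k+\alpha_k(v^k-x^k)$; $z^{k+1}=z^k+\sigma_k\max\{-z^k/\lambda_k,\ g(x^{k+1})\}$. *)

theory Defs
  imports "HOL-Analysis.Analysis" "HOL-Library.Landau_Symbols"
begin

definition grad :: "('a::euclidean_space \<Rightarrow> real) \<Rightarrow> 'a \<Rightarrow> 'a" where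
  "grad f x = (THE D. GDERIV f x :> D)"

lemma GDERIV_unique_euclidean:
  fixes f :: "'a::euclidean_space \<Rightarrow> real"
  assumes "GDERIV f x :> D" "GDERIV f x :> E"
  shows "D = E"
proof -
  have "(\<lambda>h. h \<bullet> D) = (\<lambda>h. h \<bullet> E)"
    using assms unfolding gderiv_def by (rule has_derivative_unique)
  then have "\<And>h. h \<bullet> D = h \<bullet> E" by meson
  then show ?thesis using vector_eq_ldot by blast
qed

lemma grad_eqI:
  fixes f :: "'a::euclidean_space \<Rightarrow> real"
  assumes "GDERIV f x :> D"
  shows "grad f x = D"
  unfolding grad_def using assms GDERIV_unique_euclidean by blast

lemma GDERIV_grad:
  fixes f :: "'a::euclidean_space \<Rightarrow> real"
  assumes "f differentiable (at x)"
  shows "GDERIV f x :> grad f x"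
proof -
  obtain f' where f': "(f has_derivative f') (at x)"
    using assms unfolding differentiable_def by blast
  then have lin: "linear f'"
    by (rule has_derivative_linear)
  define D where "D = (\<Sum>b\<in>Basis. f' b *\<^sub>R b)"
  have "f' h = h \<bullet> D" for h
  proof -
    have "f' h = f' (\<Sum>b\<in>Basis. (h \<bullet> b) *\<^sub>R b)"
      by (simp add: euclidean_representation)
    also have "\<dots> = (\<Sum>b\<in>Basis. (h \<bullet> b) * f' b)"
      using lin by (simp add: linear_sum linear_cmul)
    also have "\<dots> = h \<bullet> D"
      by (simp add: D_def inner_sum_right mult.commute)
    finally show ?thesis .
  qed
  then have "f' = (\<lambda>h. h \<bullet> D)" by blast
  with f' have "GDERIV f x :> D" by (simp add: gderiv_def)
  then show ?thesis using grad_eqI by fastforce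
qed

definition edom :: "('a \<Rightarrow> ereal) \<Rightarrow> 'a set" where
  "edom h = {x. h x < \<infinity>}"

definition proper_fun :: "('a \<Rightarrow> ereal) \<Rightarrow> bool" where
  "proper_fun h \<longleftrightarrow> (\<forall>x. h x > -\<infinity>) \<and> edom h \<noteq> {}"

definition ereal_epigraph :: "('a \<Rightarrow> ereal) \<Rightarrow> ('a \<times> real) set" where
  "ereal_epigraph h = {(x, r). h x \<le> ereal r}"

definition ind_fun :: "'a set \<Rightarrow> 'a \<Rightarrow> ereal" where
  "ind_fun C x = (if x \<in> C then 0 else \<infinity>)"

definition subdiff :: "('a::real_inner \<Rightarrow> ereal) \<Rightarrow> 'a \<Rightarrow> 'a set" where
  "subdiff h x = {s. \<forall>y. h x + ereal (s \<bullet> (y - x)) \<le> h y}"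

definition lin_argmin :: "('a::real_inner \<Rightarrow> ereal) \<Rightarrow> 'a \<Rightarrow> 'a set" where
  "lin_argmin h u = {v. is_arg_min (\<lambda>w. ereal (w \<bullet> u) + h w) (\<lambda>_. True) v}"

definition uniformly_convex_set :: "real \<Rightarrow> real \<Rightarrow> 'a::real_normed_vector set \<Rightarrow> bool" where
  "uniformly_convex_set \<nu> q S \<longleftrightarrow> 0 < \<nu> \<and> 2 \<le> q \<and> convex S \<and>
    (\<forall>x\<in>S. \<forall>y\<in>S. \<forall>t\<in>{0..1}. \<forall>w. norm w = 1 \<longrightarrow>
      t *\<^sub>R x + (1 - t) *\<^sub>R y + (t * (1 - t) * \<nu> * norm (x - y) powr q) *\<^sub>R w \<in> S)"

definition kkt_point ::
  "(real^'n \<Rightarrow> real) \<Rightarrow> (real^'n \<Rightarrow> ereal) \<Rightarrow> (real^'n \<Rightarrow> real^'m) \<Rightarrow> real^'n \<Rightarrow> real^'m \<Rightarrow> bool" where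
  "kkt_point f h g x z \<longleftrightarrow>
    (\<exists>s\<in>subdiff h x. grad f x + s + (\<Sum>i\<in>UNIV. z $ i *\<^sub>R grad (\<lambda>y. g y $ i) x) = 0) \<and>
    g x \<le> 0 \<and> 0 \<le> z \<and> z \<bullet> g x = 0"

locale convex_program =
  fixes f :: "real^'n \<Rightarrow> real" and h :: "real^'n \<Rightarrow> ereal" and g :: "real^'n \<Rightarrow> real^'m"
    and Lf D :: real and Lg B :: "'m \<Rightarrow> real"
  assumes f_convex: "convex_on UNIV f"
    and f_diff: "\<And>x. f differentiable (at x)"
    and Lf_pos: "0 < Lf"
    and f_smooth: "Lf-lipschitz_on UNIV (grad f)"
    and h_proper: "proper_fun h"
    and h_closed: "closed (ereal_epigraph h)"
    and h_convex: "convex (ereal_epigraph h)"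
    and D_pos: "0 < D"
    and dom_bound: "\<And>x y. x \<in> edom h \<Longrightarrow> y \<in> edom h \<Longrightarrow> norm (x - y) \<le> D"
    and argmin_ex: "\<And>u. lin_argmin h u \<noteq> {}"
    and g_convex: "\<And>i. convex_on UNIV (\<lambda>x. g x $ i)"
    and g_diff: "\<And>i x. (\<lambda>y. g y $ i) differentiable (at x)"
    and Lg_pos: "\<And>i. 0 < Lg i"
    and g_smooth: "\<And>i. (Lg i)-lipschitz_on (edom h) (grad (\<lambda>y. g y $ i))"
    and kkt_ex: "\<exists>x z. kkt_point f h g x z"
    and B_pos: "\<And>i. 0 < B i"
    and grad_g_bound: "\<And>i x. x \<in> edom h \<Longrightarrow> norm (grad (\<lambda>y. g y $ i) x) \<le> B i"
    and g_lipschitz: "\<And>i. (B i)-lipschitz_on (edom h) (\<lambda>x. g x $ i)"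

definition opt_value ::
  "(real^'n \<Rightarrow> real) \<Rightarrow> (real^'n \<Rightarrow> ereal) \<Rightarrow> (real^'n \<Rightarrow> real^'m) \<Rightarrow> ereal" where
  "opt_value f h g = (INF x\<in>{x. g x \<le> 0}. ereal (f x) + h x)"

definition pos_part :: "real \<Rightarrow> real" where
  "pos_part a = max a 0"

definition pos_part_vec :: "real^'m \<Rightarrow> real^'m" where
  "pos_part_vec a = (\<chi> i. pos_part (a $ i))"

definition near_active :: "(real^'n \<Rightarrow> real^'m) \<Rightarrow> real \<Rightarrow> ((real^'n) \<times> (real^'m)) set" where
  "near_active g \<epsilon> = {(x, z). 0 \<le> z \<and> (\<forall>i. g x $ i \<le> \<epsilon>) \<and> (\<forall>i. g x $ i < -\<epsilon> \<longrightarrow> z $ i = 0)}"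

definition Psi :: "(real^'n \<Rightarrow> real^'m) \<Rightarrow> real \<Rightarrow> real^'n \<Rightarrow> real^'m \<Rightarrow> real" where
  "Psi g lam x z = lam / 2 * (\<Sum>i\<in>UNIV. (pos_part (g x $ i + z $ i / lam))\<^sup>2 - (z $ i / lam)\<^sup>2)"

definition F_al ::
  "(real^'n \<Rightarrow> real) \<Rightarrow> (real^'n \<Rightarrow> real^'m) \<Rightarrow> real \<Rightarrow> real^'n \<Rightarrow> real^'m \<Rightarrow> real" where
  "F_al f g lam x z = f x + Psi g lam x z"

definition grad_F ::
  "(real^'n \<Rightarrow> real) \<Rightarrow> (real^'n \<Rightarrow> real^'m) \<Rightarrow> real \<Rightarrow> real^'n \<Rightarrow> real^'m \<Rightarrow> real^'n" where
  "grad_F f g lam x z = grad (\<lambda>y. F_al f g lam y z) x"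

definition L_Psi ::
  "(real^'n \<Rightarrow> real^'m) \<Rightarrow> ('m \<Rightarrow> real) \<Rightarrow> ('m \<Rightarrow> real) \<Rightarrow> real \<Rightarrow> real^'n \<Rightarrow> real^'m \<Rightarrow> real" where
  "L_Psi g Lg B lam x z = (\<Sum>i\<in>UNIV. lam * (B i)\<^sup>2 + Lg i * pos_part (lam * g x $ i + z $ i))"

(* The value does not depend on the minimizer selected by SOME, see gap_eq. *)
definition gap ::
  "(real^'n \<Rightarrow> real) \<Rightarrow> (real^'n \<Rightarrow> ereal) \<Rightarrow> (real^'n \<Rightarrow> real^'m) \<Rightarrow> real^'m \<Rightarrow> real \<Rightarrow> real^'n \<Rightarrow> ereal"
  where
  "gap f h g z lam x =
    (let u = grad_F f g lam x z; v = (SOME v. v \<in> lin_argmin h u)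
     in ereal (u \<bullet> (x - v)) + h x - h v)"

lemma lin_argmin_finite:
  assumes "proper_fun h" "v \<in> lin_argmin h u"
  shows "\<bar>h v\<bar> \<noteq> \<infinity>"
proof -
  obtain y where y: "h y < \<infinity>"
    using assms(1) by (auto simp: proper_fun_def edom_def)
  have "ereal (v \<bullet> u) + h v \<le> ereal (y \<bullet> u) + h y"
    using assms(2) by (simp add: lin_argmin_def is_arg_min_def not_less)
  also have "\<dots> < \<infinity>" using y by (cases "h y") auto
  finally have "h v \<noteq> \<infinity>" by auto
  moreover have "h v > -\<infinity>" using assms(1) by (simp add: proper_fun_def)
  ultimately show ?thesis by auto
qed

lemma gap_eq:
  assumes h: "proper_fun h" and v: "v \<in> lin_argmin h (grad_F f g lam x z)"
  shows "gap f h g z lam x = ereal (grad_F f g lam x z \<bullet> (x - v)) + h x - h v"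
proof -
  let ?u = "grad_F f g lam x z"
  define w where "w = (SOME v. v \<in> lin_argmin h ?u)"
  have w: "w \<in> lin_argmin h ?u"
    unfolding w_def using v by (rule someI)
  have eq: "ereal (v \<bullet> ?u) + h v = ereal (w \<bullet> ?u) + h w"
    using v w by (intro antisym) (simp_all add: lin_argmin_def is_arg_min_def not_less)
  obtain a b where ab: "h v = ereal a" "h w = ereal b"
    using lin_argmin_finite[OF h v] lin_argmin_finite[OF h w] by auto
  have "gap f h g z lam x = ereal (?u \<bullet> (x - w)) + h x - h w"
    by (simp add: gap_def w_def Let_def)
  also have "\<dots> = ereal (?u \<bullet> (x - v)) + h x - h v"
    using eq ab by (cases "h x") (simp_all add: inner_diff_right inner_commute[of "grad_F f g lam x z"])
  finally show ?thesis .
qed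

(* The gap is finite whenever x lies in the domain of h, as for all iterates. *)
definition short_step ::
  "(real^'n \<Rightarrow> real) \<Rightarrow> (real^'n \<Rightarrow> ereal) \<Rightarrow> (real^'n \<Rightarrow> real^'m) \<Rightarrow> real \<Rightarrow> ('m \<Rightarrow> real) \<Rightarrow> ('m \<Rightarrow> real)
    \<Rightarrow> real^'n \<Rightarrow> real^'m \<Rightarrow> real^'n \<Rightarrow> real \<Rightarrow> real" where
  "short_step f h g Lf Lg B x z v lam =
    (if gap f h g z lam x = 0 \<and> norm (v - x) = 0 then 0
     else min 1 (real_of_ereal (gap f h g z lam x)
                  / ((L_Psi g Lg B lam x z + Lf) * (norm (v - x))\<^sup>2)))"

definition al_fw_sequence ::
  "(real^'n \<Rightarrow> real) \<Rightarrow> (real^'n \<Rightarrow> ereal) \<Rightarrow> (real^'n \<Rightarrow> real^'m)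
    \<Rightarrow> (nat \<Rightarrow> real) \<Rightarrow> (nat \<Rightarrow> real) \<Rightarrow> (nat \<Rightarrow> real)
    \<Rightarrow> (nat \<Rightarrow> real^'n) \<Rightarrow> (nat \<Rightarrow> real^'m) \<Rightarrow> (nat \<Rightarrow> real^'n) \<Rightarrow> bool" where
  "al_fw_sequence f h g lam \<sigma> \<alpha> x z v \<longleftrightarrow>
    (\<forall>k. 0 < lam k \<and> lam k < lam (Suc k)) \<and> filterlim lam at_top sequentially \<and>
    (\<forall>k. 0 < \<sigma> k \<and> \<sigma> k \<le> lam k) \<and> summable \<sigma> \<and>
    (\<forall>k. \<alpha> k \<in> {0..1}) \<and>
    x 0 \<in> edom h \<and> 0 \<le> z 0 \<and>
    (\<forall>k. v k \<in> lin_argmin h (grad_F f g (lam k) (x k) (z k)) \<and>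
         x (Suc k) = x k + \<alpha> k *\<^sub>R (v k - x k) \<and>
         z (Suc k) = z k + \<sigma> k *\<^sub>R (\<chi> i. max (- (z k $ i) / lam k) (g (x (Suc k)) $ i)))"

(* Under the standing assumptions the KKT point is optimal, so the optimal value is finite, and h
   is finite at the iterates; real_of_ereal is thus applied to a finite number only. *)
definition residual ::
  "(real^'n \<Rightarrow> real) \<Rightarrow> (real^'n \<Rightarrow> ereal) \<Rightarrow> (real^'n \<Rightarrow> real^'m) \<Rightarrow> real^'n \<Rightarrow> real" where
  "residual f h g x =
    max \<bar>real_of_ereal (ereal (f x) + h x - opt_value f h g)\<bar> (norm (pos_part_vec (g x)))"

end

theory Submission
  imports Defs
begin

text \<open>
  Write \<open>\<delta>\<^sub>k = F\<^sub>k(x\<^sub>k) - L\<^sup>*\<close>, where \<open>F\<^sub>k\<close> is the augmented Lagrangian at \<open>(\<lambda>\<^sub>k, z\<^sub>k)\<close>. Each summand of the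
  penalty is the maximum over \<open>w \<ge> 0\<close> of \<open>w s - (w - z)\<^sup>2 / (2 \<lambda>)\<close>. Together with the saddle point inequality,
  suitable choices of \<open>w\<close> show that the residual is \<open>O(max 0 \<delta>\<^sub>k + 1 / \<lambda>\<^sub>k)\<close>, that the squared
  infeasibility is \<open>O(\<delta>\<^sub>k / \<lambda>\<^sub>k + 1 / \<lambda>\<^sub>k\<^sup>2)\<close>, and hence that changing \<open>(\<lambda>\<^sub>k, z\<^sub>k)\<close> raises \<open>F\<^sub>k\<close> only
  by \<open>O((max 0 \<delta>\<^sub>k + k\<^sup>-\<^sup>\<tau>) / k)\<close>. The short step decreases \<open>F\<^sub>k\<close> by at least
  \<open>min G\<^sub>k (G\<^sub>k\<^sup>2 / (L\<^sub>k d\<^sub>k\<^sup>2)) / 2\<close> with \<open>G\<^sub>k \<ge> \<delta>\<^sub>k\<close>, \<open>L\<^sub>k = O(\<lambda>\<^sub>k)\<close> and \<open>d\<^sub>k = |v\<^sub>k - x\<^sub>k|\<close>.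

  The resulting recursion is used twice. With \<open>d\<^sub>k \<le> D\<close> alone it gives a decrease of order
  \<open>\<delta>\<^sub>k\<^sup>2 k\<^sup>-\<^sup>\<tau>\<close>, so \<open>max 0 \<delta>\<^sub>k\<close> tends to zero; therefore the gradient of \<open>F\<^sub>k\<close> is eventually bounded away
  from zero by assumption (b), and uniform convexity gives \<open>G\<^sub>k \<ge> c d\<^sub>k\<^sup>q\<close>. This improves the decrease to
  order \<open>\<delta>\<^sub>k\<^sup>1\<^sup>+\<^sup>\<mu> k\<^sup>-\<^sup>\<tau>\<close>, which yields \<open>O(k\<^sup>-\<^sup>\<rho>)\<close> whenever \<open>\<rho> \<le> \<tau>\<close> and \<open>\<mu> \<rho> \<le> 1 - \<tau>\<close>.
\<close>

subsection \<open>The scalar augmented Lagrangian penalty\<close>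

text \<open>The Powell-Hestenes-Rockafellar penalty of a single inequality constraint with value
  \<open>s\<close> and multiplier \<open>z\<close>.\<close>

definition al_pen :: "real \<Rightarrow> real \<Rightarrow> real \<Rightarrow> real" where
  "al_pen lam z s = lam / 2 * ((pos_part (s + z / lam))\<^sup>2 - (z / lam)\<^sup>2)"

lemma Psi_eq_sum_al_pen: "Psi g lam x z = (\<Sum>i\<in>UNIV. al_pen lam (z $ i) (g x $ i))"
  by (simp add: Psi_def al_pen_def sum_distrib_left)

lemma pos_part_nonneg [simp]: "0 \<le> pos_part a"
  by (simp add: pos_part_def)

lemma pos_part_ge: "a \<le> pos_part a"
  by (simp add: pos_part_def)

text \<open>The projected multiplier \<open>pos_part (lam * s + z)\<close> attains the maximum in
  the dual representation whose lower bound is \<open>al_pen_ge\<close>.\<close>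

lemma al_pen_eq:
  assumes "0 < lam"
  shows "al_pen lam z s = pos_part (lam * s + z) * s - (pos_part (lam * s + z) - z)\<^sup>2 / (2 * lam)"
proof (cases "0 \<le> lam * s + z")
  case True
  then have "0 \<le> s + z / lam" using assms by (simp add: field_simps)
  then show ?thesis using True assms
    by (simp add: al_pen_def pos_part_def field_simps power2_eq_square)
next
  case False
  then have "s + z / lam < 0" using assms by (simp add: field_simps)
  then show ?thesis using False assms
    by (simp add: al_pen_def pos_part_def field_simps power2_eq_square)
qed

text \<open>After completing the square in \<open>z\<close>, this is Young's inequality for the
  product of \<open>w\<close> and the positive part of \<open>s + z / lam\<close>.\<close>

lemma al_pen_ge:
  assumes "0 < lam" "0 \<le> w"
  shows "w * s - (w - z)\<^sup>2 / (2 * lam) \<le> al_pen lam z s"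
proof -
  define p where "p = pos_part (s + z / lam)"
  have "w * (s + z / lam) \<le> w * p"
    using assms by (intro mult_left_mono) (auto simp: p_def pos_part_ge)
  moreover have "w * p \<le> lam / 2 * p\<^sup>2 + w\<^sup>2 / (2 * lam)"
  proof -
    have "0 \<le> (lam * p - w)\<^sup>2 / (2 * lam)" using assms by simp
    also have "\<dots> = lam / 2 * p\<^sup>2 + w\<^sup>2 / (2 * lam) - w * p"
      using assms by (simp add: field_simps power2_eq_square)
    finally show ?thesis by simp
  qed
  moreover have "w * s - (w - z)\<^sup>2 / (2 * lam)
      = w * (s + z / lam) - w\<^sup>2 / (2 * lam) - lam / 2 * (z / lam)\<^sup>2"
    using assms by (simp add: field_simps power2_eq_square)
  moreover have "al_pen lam z s = lam / 2 * p\<^sup>2 - lam / 2 * (z / lam)\<^sup>2"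
    by (simp add: al_pen_def p_def algebra_simps)
  ultimately show ?thesis by linarith
qed

text \<open>A maximum of functions affine in \<open>s\<close> has the slope of the maximizing one as
  a subgradient, so the maximizer at \<open>s\<close> is tested at \<open>t\<close>.\<close>

lemma al_pen_tangent_le:
  assumes "0 < lam"
  shows "al_pen lam z s + pos_part (lam * s + z) * (t - s) \<le> al_pen lam z t"
  using al_pen_ge[OF assms, of "pos_part (lam * s + z)" t z] al_pen_eq[OF assms, of z s]
  by (simp add: algebra_simps)

lemma pos_part_square_le:
  "(pos_part b)\<^sup>2 \<le> (pos_part a)\<^sup>2 + 2 * pos_part a * (b - a) + (b - a)\<^sup>2"
proof -
  have "(pos_part b)\<^sup>2 \<le> (pos_part a + (b - a))\<^sup>2"
  proof (cases "0 \<le> b")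
    case True
    then show ?thesis by (auto simp: pos_part_def intro!: power_mono)
  next
    case False
    then show ?thesis by (simp add: pos_part_def)
  qed
  then show ?thesis by (simp add: power2_sum)
qed

lemma al_pen_quadratic_upper:
  assumes "0 < lam"
  shows "al_pen lam z t \<le> al_pen lam z s + pos_part (lam * s + z) * (t - s) + lam / 2 * (t - s)\<^sup>2"
proof -
  have p: "pos_part (lam * s + z) = lam * pos_part (s + z / lam)"
    using assms by (auto simp: pos_part_def max_def field_simps)
  have "lam / 2 * (pos_part (t + z / lam))\<^sup>2 \<le>
      lam / 2 * ((pos_part (s + z / lam))\<^sup>2 + 2 * pos_part (s + z / lam) * (t - s) + (t - s)\<^sup>2)"
    using assms pos_part_square_le[of "t + z / lam" "s + z / lam"]
    by (intro mult_left_mono) auto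
  then show ?thesis unfolding p al_pen_def by (simp add: algebra_simps)
qed

text \<open>The difference quotient is squeezed between the tangent bound and the quadratic bound,
  which avoids a case split at the kink of the positive part.\<close>

lemma al_pen_DERIV:
  assumes "0 < lam"
  shows "(al_pen lam z has_field_derivative pos_part (lam * s + z)) (at s)"
proof -
  let ?d = "pos_part (lam * s + z)"
  let ?r = "\<lambda>h. (al_pen lam z (s + h) - al_pen lam z s) / h - ?d"
  have bd: "norm (?r h) \<le> lam / 2 * \<bar>h\<bar>" if "h \<noteq> 0" for h
  proof -
    have "\<bar>al_pen lam z (s + h) - al_pen lam z s - ?d * h\<bar> \<le> lam / 2 * h\<^sup>2"
      using al_pen_tangent_le[OF assms, of z s "s + h"]
        al_pen_quadratic_upper[OF assms, of z "s + h" s] by (simp add: abs_le_iff)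
    moreover have "?r h = (al_pen lam z (s + h) - al_pen lam z s - ?d * h) / h"
      using that by (simp add: field_simps)
    moreover have "lam / 2 * h\<^sup>2 / \<bar>h\<bar> = lam / 2 * \<bar>h\<bar>"
      using that by (simp add: power2_eq_square field_simps)
    ultimately show ?thesis
      by (metis abs_divide abs_ge_zero divide_right_mono real_norm_def)
  qed
  have "(\<lambda>h. lam / 2 * \<bar>h\<bar>) \<midarrow>0\<rightarrow> 0" by (intro tendsto_eq_intros) auto
  then have "?r \<midarrow>0\<rightarrow> 0"
    by (rule Lim_null_comparison[rotated]) (use bd in \<open>auto simp del: real_norm_def simp: eventually_at intro!: exI[of _ 1]\<close>)
  then show ?thesis
    unfolding DERIV_def by (rule LIM_zero_cancel)
qed

lemma al_pen_nonpos:
  assumes "0 < lam" "s \<le> 0" "0 \<le> z"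
  shows "al_pen lam z s \<le> 0"
proof -
  have "pos_part (s + z / lam) \<le> z / lam" using assms by (simp add: pos_part_def)
  then have "(pos_part (s + z / lam))\<^sup>2 \<le> (z / lam)\<^sup>2" by (intro power_mono) auto
  then show ?thesis using assms by (simp add: al_pen_def mult_nonneg_nonpos)
qed

lemma al_pen_ge_neg:
  assumes "0 < lam"
  shows "- (z\<^sup>2 / (2 * lam)) \<le> al_pen lam z s"
  using al_pen_ge[OF assms, of 0 s z] by simp

text \<open>The maximizer \<open>w\<close> for the new parameters is tested in the dual
  representation for the old ones. The terms linear in \<open>s\<close> cancel, and the remaining
  quadratic terms are all of order \<open>e\<^sup>2\<close>.\<close>

lemma al_pen_parameter_change:
  assumes lam: "0 < lam" "lam \<le> lam'" "lam' \<le> R * lam"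
    and z: "0 \<le> z'" "z' \<le> Z"
    and sig: "0 \<le> \<sigma>" "\<sigma> \<le> lam"
    and dz: "\<bar>z' - z\<bar> \<le> \<sigma> * (pos_part s + Z / lam)"
  shows "al_pen lam' z' s - al_pen lam z s
    \<le> 2 * R\<^sup>2 * (lam' - lam + \<sigma>) * (pos_part s + Z / lam)\<^sup>2"
proof -
  define e where "e = pos_part s + Z / lam"
  define w where "w = pos_part (lam' * s + z')"
  define t where "t = w - z'"
  have lam': "0 < lam'" using lam by simp
  have Z: "0 \<le> Z" using z by simp
  have e0: "0 \<le> e" using Z lam by (simp add: e_def)
  have R1: "1 \<le> R"
  proof (rule ccontr)
    assume "\<not> 1 \<le> R"
    then have "R * lam < 1 * lam" using lam by (intro mult_strict_right_mono) auto
    then show False using lam by linarith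
  qed
  \<comment> \<open>\<open>t\<close> equals the larger of \<open>lam' * s\<close> and
    \<open>- z'\<close>.\<close>
  have t: "\<bar>t\<bar> \<le> R * lam * e"
  proof -
    have "\<bar>t\<bar> \<le> lam' * pos_part s + Z"
    proof (cases "0 \<le> s")
      case True
      then have "0 \<le> lam' * s" using lam' by simp
      then show ?thesis using z True by (simp add: t_def w_def pos_part_def)
    next
      case False
      then have "lam' * s \<le> 0" using lam' by (simp add: mult_nonneg_nonpos)
      then show ?thesis using z False by (simp add: t_def w_def pos_part_def)
    qed
    also have "\<dots> \<le> R * lam * pos_part s + R * Z"
      using lam R1 Z mult_right_mono[of 1 R Z] by (intro add_mono mult_right_mono) auto
    also have "\<dots> = R * lam * e" using lam by (simp add: e_def field_simps)
    finally show ?thesis .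
  qed
  have eq: "al_pen lam' z' s = w * s - t\<^sup>2 / (2 * lam')"
    using al_pen_eq[OF lam'] by (simp add: w_def t_def)
  have "w * s - (t + (z' - z))\<^sup>2 / (2 * lam) \<le> al_pen lam z s"
    using al_pen_ge[OF lam(1), of w s z] by (simp add: w_def t_def)
  then have "al_pen lam' z' s - al_pen lam z s
      \<le> (t + (z' - z))\<^sup>2 / (2 * lam) - t\<^sup>2 / (2 * lam')"
    using eq by linarith
  \<comment> \<open>The three terms separate the growth of the penalty parameter, the cross term and
    the change of the multiplier.\<close>
  also have "\<dots> = t\<^sup>2 * (lam' - lam) / (2 * lam * lam') + t * (z' - z) / lam + (z' - z)\<^sup>2 / (2 * lam)"
    using lam lam' by (simp add: field_simps power2_eq_square)
  also have "\<dots> \<le> R\<^sup>2 * e\<^sup>2 * (lam' - lam) + R * \<sigma> * e\<^sup>2 + \<sigma> * e\<^sup>2"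
  proof (intro add_mono)
    have "t\<^sup>2 \<le> (R * lam * e)\<^sup>2" using t by (metis abs_ge_zero power2_abs power_mono)
    then have "t\<^sup>2 * (lam' - lam) / (2 * lam * lam') \<le> (R * lam * e)\<^sup>2 * (lam' - lam) / (lam * lam)"
      using lam lam' by (intro frac_le mult_mono mult_right_mono) auto
    then show "t\<^sup>2 * (lam' - lam) / (2 * lam * lam') \<le> R\<^sup>2 * e\<^sup>2 * (lam' - lam)"
      using lam by (simp add: power2_eq_square mult_ac)
    have "t * (z' - z) \<le> \<bar>t\<bar> * \<bar>z' - z\<bar>" by (metis abs_ge_self abs_mult)
    also have "\<dots> \<le> (R * lam * e) * (\<sigma> * e)"
      using t dz lam e0 R1 by (intro mult_mono) (auto simp: e_def)
    finally show "t * (z' - z) / lam \<le> R * \<sigma> * e\<^sup>2"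
      using lam by (simp add: field_simps power2_eq_square)
    have "(z' - z)\<^sup>2 \<le> (\<sigma> * e)\<^sup>2"
      using dz unfolding e_def by (metis abs_ge_zero power2_abs power_mono)
    also have "\<dots> \<le> lam * \<sigma> * e\<^sup>2"
      using sig mult_right_mono[of \<sigma> lam "\<sigma> * e\<^sup>2"]
      by (simp add: power_mult_distrib power2_eq_square[of \<sigma>] mult.assoc)
    also have "\<dots> \<le> (2 * lam) * (\<sigma> * e\<^sup>2)" using sig lam by (simp add: mult_right_mono)
    finally show "(z' - z)\<^sup>2 / (2 * lam) \<le> \<sigma> * e\<^sup>2"
      using lam by (simp add: divide_le_eq mult_ac)
  qed
  also have "\<dots> \<le> 2 * R\<^sup>2 * (lam' - lam + \<sigma>) * e\<^sup>2"
  proof -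
    have "R \<le> R\<^sup>2" using R1 by (simp add: power2_eq_square)
    then have "R * (\<sigma> * e\<^sup>2) \<le> R\<^sup>2 * (\<sigma> * e\<^sup>2)" "1 * (\<sigma> * e\<^sup>2) \<le> R\<^sup>2 * (\<sigma> * e\<^sup>2)"
      using R1 sig by (intro mult_right_mono; simp)+
    moreover have "0 \<le> R\<^sup>2 * e\<^sup>2 * (lam' - lam)" using lam by simp
    ultimately show ?thesis by (simp add: algebra_simps)
  qed
  finally show ?thesis by (simp add: e_def)
qed

subsection \<open>Gradient inequalities and uniformly convex sets\<close>

lemma convex_gradient_inequality:
  fixes f :: "'a::euclidean_space \<Rightarrow> real"
  assumes "convex_on UNIV f" "f differentiable (at x)"
  shows "f x + grad f x \<bullet> (y - x) \<le> f y"
proof -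
  define \<phi> where "\<phi> t = f (x + t *\<^sub>R (y - x))" for t
  have "(f has_derivative (\<lambda>h. h \<bullet> grad f x)) (at (x + 0 *\<^sub>R (y - x)))"
    using GDERIV_grad[OF assms(2)] by (simp add: gderiv_def)
  then have "(\<phi> has_derivative (\<lambda>t. (t *\<^sub>R (y - x)) \<bullet> grad f x)) (at 0)"
    unfolding \<phi>_def
    by (rule has_derivative_compose[rotated]) (auto intro!: derivative_eq_intros)
  then have d: "(\<phi> has_field_derivative (y - x) \<bullet> grad f x) (at 0)"
    by (simp add: has_field_derivative_def mult_commute_abs)
  have "convex_on UNIV \<phi>"
  proof (rule convex_onI)
    fix t a b :: real assume t: "0 < t" "t < 1"
    have "x + ((1 - t) *\<^sub>R a + t *\<^sub>R b) *\<^sub>R (y - x)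
        = (1 - t) *\<^sub>R (x + a *\<^sub>R (y - x)) + t *\<^sub>R (x + b *\<^sub>R (y - x))"
      by (simp add: algebra_simps)
    then show "\<phi> ((1 - t) *\<^sub>R a + t *\<^sub>R b) \<le> (1 - t) * \<phi> a + t * \<phi> b"
      unfolding \<phi>_def using convex_onD[OF assms(1), of t] t by simp
  qed simp
  then have "((y - x) \<bullet> grad f x) * (1 - 0) \<le> \<phi> 1 - \<phi> 0"
    by (rule convex_on_imp_above_tangent[where A = UNIV]) (use d in auto)
  then show ?thesis by (simp add: \<phi>_def inner_commute)
qed

text \<open>Descent lemma: \<open>f\<close> along the segment minus its quadratic majorant has
  nonpositive derivative. The segment stays in \<open>S\<close>, the only place where the gradient
  is known to be Lipschitz.\<close>

lemma lipschitz_gradient_upper: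
  fixes f :: "'a::euclidean_space \<Rightarrow> real"
  assumes "convex S" "x \<in> S" "y \<in> S"
    and diff: "\<And>u. f differentiable (at u)"
    and lip: "L-lipschitz_on S (grad f)"
  shows "f y \<le> f x + grad f x \<bullet> (y - x) + L / 2 * (norm (y - x))\<^sup>2"
proof -
  define p where "p t = x + t *\<^sub>R (y - x)" for t
  define \<phi> where "\<phi> t = f (p t) - t * (grad f x \<bullet> (y - x)) - L / 2 * t\<^sup>2 * (norm (y - x))\<^sup>2" for t
  have der: "(\<phi> has_field_derivative
      (grad f (p t) - grad f x) \<bullet> (y - x) - L * t * (norm (y - x))\<^sup>2) (at t)" for t
  proof -
    have "(f has_derivative (\<lambda>h. h \<bullet> grad f (p t))) (at (p t))"
      using GDERIV_grad[OF diff] by (simp add: gderiv_def)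
    then have "((\<lambda>t. f (p t)) has_derivative (\<lambda>s. (s *\<^sub>R (y - x)) \<bullet> grad f (p t))) (at t)"
      by (rule has_derivative_compose[rotated]) (auto simp: p_def[abs_def] intro!: derivative_eq_intros)
    then have "((\<lambda>t. f (p t)) has_field_derivative (y - x) \<bullet> grad f (p t)) (at t)"
      by (simp add: has_field_derivative_def mult_commute_abs)
    then show ?thesis unfolding \<phi>_def
      by (auto intro!: derivative_eq_intros simp: inner_diff_left inner_diff_right inner_commute)
  qed
  have "\<phi> 1 \<le> \<phi> 0"
  proof (rule DERIV_nonpos_imp_nonincreasing[where f = \<phi> and a = 0 and b = 1])
    fix t :: real assume t: "0 \<le> t" "t \<le> 1"
    have "p t \<in> S"
    proof -
      have "p t = (1 - t) *\<^sub>R x + t *\<^sub>R y" by (simp add: p_def algebra_simps)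
      then show ?thesis using convexD_alt[OF assms(1-3) t] by simp
    qed
    then have "norm (grad f (p t) - grad f x) \<le> L * norm (p t - x)"
      using lipschitz_onD[OF lip] assms by (simp add: dist_norm)
    then have n: "norm (grad f (p t) - grad f x) \<le> L * (t * norm (y - x))"
      using t by (simp add: p_def)
    have "(grad f (p t) - grad f x) \<bullet> (y - x) \<le> norm (grad f (p t) - grad f x) * norm (y - x)"
      by (rule norm_cauchy_schwarz)
    also have "\<dots> \<le> L * (t * norm (y - x)) * norm (y - x)"
      using n by (intro mult_right_mono) auto
    finally have "(grad f (p t) - grad f x) \<bullet> (y - x) - L * t * (norm (y - x))\<^sup>2 \<le> 0"
      by (simp add: power2_eq_square mult_ac)
    then show "\<exists>d. (\<phi> has_field_derivative d) (at t) \<and> d \<le> 0" using der by blast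
  qed simp
  then show ?thesis by (simp add: \<phi>_def p_def)
qed

text \<open>The midpoint of \<open>x\<close> and \<open>v\<close> can be pushed inside
  \<open>S\<close> by \<open>r\<close> in the direction of \<open>- u\<close>. Minimality of
  \<open>v\<close> against this point gives the growth.\<close>

lemma uniformly_convex_linear_growth:
  fixes S :: "'a::euclidean_space set"
  assumes uc: "uniformly_convex_set \<nu> q S"
    and v: "v \<in> S" "\<And>w. w \<in> S \<Longrightarrow> u \<bullet> v \<le> u \<bullet> w" and x: "x \<in> S"
  shows "\<nu> / 2 * norm u * norm (x - v) powr q \<le> u \<bullet> (x - v)"
proof (cases "u = 0")
  case False
  define w where "w = - (1 / norm u) *\<^sub>R u"
  define r where "r = 1 / 4 * \<nu> * norm (x - v) powr q"
  have "norm w = 1" using False by (simp add: w_def)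
  then have "(1/2) *\<^sub>R x + (1 - 1/2) *\<^sub>R v + ((1/2) * (1 - 1/2) * \<nu> * norm (x - v) powr q) *\<^sub>R w \<in> S"
    using uc v x unfolding uniformly_convex_set_def by (metis atLeastAtMost_iff half_bounded_equal le_numeral_extra(4) zero_le_divide_1_iff zero_le_numeral divide_le_eq_1_pos one_le_numeral zero_less_numeral)
  then have "(1/2) *\<^sub>R x + (1/2) *\<^sub>R v + r *\<^sub>R w \<in> S" by (simp add: r_def)
  then have "u \<bullet> v \<le> u \<bullet> ((1/2) *\<^sub>R x + (1/2) *\<^sub>R v + r *\<^sub>R w)" by (rule v(2))
  also have "\<dots> = (u \<bullet> x) / 2 + (u \<bullet> v) / 2 - r * norm u"
    using False by (simp add: inner_add_right inner_diff_right w_def power2_norm_eq_inner[symmetric] power2_eq_square)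
  finally show ?thesis by (simp add: r_def inner_diff_right algebra_simps)
qed (use uc in auto)

subsection \<open>Perturbed descent recursions\<close>

text \<open>From \<open>ln (1 + t) \<le> t\<close> and \<open>1 + s \<le> exp s\<close>. It lets a
  contraction by \<open>1 - \<rho> / k\<close> pay for moving the target rate from \<open>k\<close>
  to \<open>k + 1\<close>.\<close>

lemma powr_minus_Suc_ge:
  fixes \<rho> :: real
  assumes "0 < k" "0 \<le> \<rho>"
  shows "real k powr (-\<rho>) * (1 - \<rho> / real k) \<le> real (Suc k) powr (-\<rho>)"
proof -
  have k: "0 < real k" using assms by simp
  have "real (Suc k) = real k * (1 + 1 / real k)" using k by (simp add: field_simps)
  then have eq: "real (Suc k) powr (-\<rho>) = real k powr (-\<rho>) * (1 + 1 / real k) powr (-\<rho>)"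
    using k by (simp add: powr_mult)
  have "ln (1 + 1 / real k) \<le> 1 / real k" using k by (intro ln_add_one_self_le_self) auto
  then have "\<rho> * ln (1 + 1 / real k) \<le> \<rho> * (1 / real k)"
    using assms by (intro mult_left_mono) auto
  then have "1 - \<rho> / real k \<le> 1 + (- \<rho> * ln (1 + 1 / real k))" by simp
  also have "\<dots> \<le> exp (- \<rho> * ln (1 + 1 / real k))" by (rule exp_ge_add_one_self)
  also have "\<dots> = (1 + 1 / real k) powr (-\<rho>)"
    using k by (simp add: powr_def add_pos_pos[THEN less_imp_neq, symmetric])
  finally show ?thesis unfolding eq by (intro mult_left_mono) auto
qed

text \<open>Induction on \<open>a k \<le> M * k powr (-\<rho>)\<close>. Well below the bound the
  perturbation alone cannot cross it; near the bound the descent term outweighs both the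
  perturbation and the decay of the bound.\<close>

lemma perturbed_descent_rate:
  fixes a :: "nat \<Rightarrow> real" and \<mu> \<tau> \<rho> c A :: real
  assumes nonneg: "\<And>k. 0 \<le> a k"
    and rec: "\<forall>\<^sub>F k in sequentially. a (Suc k) \<le> a k
        - min (a k / 2) (c * a k powr (1 + \<mu>) * real k powr (-\<tau>))
        + A / real k * (a k + real k powr (-\<tau>))"
    and c: "0 < c" and A: "0 \<le> A" and mu: "0 \<le> \<mu>" and tau: "\<tau> < 1"
    and rho: "0 < \<rho>" "\<rho> \<le> \<tau>" "\<mu> * \<rho> \<le> 1 - \<tau>"
  shows "a \<in> O(\<lambda>k. real k powr (-\<rho>))"
proof -
  \<comment> \<open>The descent must pay \<open>2 * A * a k / k\<close> for the perturbation, once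
    the power of \<open>k\<close> is bounded by \<open>a k\<close>, and
    \<open>\<rho> * a k / k\<close> for the decay of the target.\<close>
  define B where "B = 2 * A + \<rho>"
  have B: "0 < B" using A rho by (simp add: B_def)
  \<comment> \<open>At the level \<open>M0 / 2\<close> times the target rate the descent is to beat
    \<open>B / k\<close>. For \<mu> = 0 the level does not enter and \<tau> < 1 suffices; for \<mu>
    > 0 the level is chosen with \<open>c * (M0 / 2) powr \<mu> = B\<close>, and \<tau> +
    \<mu>\<rho> \<le> 1 does the rest.\<close>
  obtain M0 where M0: "0 < M0"
    and evM: "\<forall>\<^sub>F k in sequentially. B / real k \<le> c * (M0 / 2) powr \<mu> * real k powr (-\<tau> - \<mu> * \<rho>)"
  proof (cases "\<mu> = 0")
    case True
    have "((\<lambda>k. real k powr (-(1 - \<tau>))) \<longlongrightarrow> 0) sequentially"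
      using tau by (intro tendsto_neg_powr filterlim_real_sequentially) auto
    then have "\<forall>\<^sub>F k in sequentially. real k powr (-(1 - \<tau>)) < c / B"
      by (rule order_tendstoD) (use c B in simp)
    then have "\<forall>\<^sub>F k in sequentially. B / real k \<le> c * (2 / 2) powr \<mu> * real k powr (-\<tau> - \<mu> * \<rho>)"
      using eventually_gt_at_top[of 0]
    proof eventually_elim
      case (elim k)
      have "B / real k = (B * real k powr (-(1 - \<tau>))) * real k powr (-\<tau>)"
      proof -
        have "real k powr (-(1 - \<tau>)) * real k powr (-\<tau>) = real k powr (-1)"
          by (subst powr_add[symmetric]) simp
        then show ?thesis using elim by (simp only: mult.assoc) (simp add: powr_minus_divide)
      qed
      also have "\<dots> \<le> c * real k powr (-\<tau>)"
        using elim B by (intro mult_right_mono) (auto simp: field_simps)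
      finally show ?case using True elim by simp
    qed
    then show ?thesis using that[of 2] by simp
  next
    case False
    then have mu': "0 < \<mu>" using mu by simp
    have "\<forall>\<^sub>F k in sequentially. B / real k \<le>
        c * (2 * (B / c) powr (1 / \<mu>) / 2) powr \<mu> * real k powr (-\<tau> - \<mu> * \<rho>)"
      using eventually_gt_at_top[of 0]
    proof eventually_elim
      case (elim k)
      have "B * real k powr (- 1) \<le> B * real k powr (-\<tau> - \<mu> * \<rho>)"
        using B rho elim by (intro mult_left_mono powr_mono) auto
      then show ?case using mu' elim B c by (simp add: powr_powr powr_minus_divide)
    qed
    then show ?thesis using that[of "2 * (B / c) powr (1 / \<mu>)"] B c by simp
  qed
  have "((\<lambda>k. B / real k) \<longlongrightarrow> 0) sequentially"
    by (rule lim_const_over_n)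
  then have evB: "\<forall>\<^sub>F k in sequentially. B / real k < 1 / 2"
    by (rule order_tendstoD) simp
  obtain k0 where k0: "\<And>k. k0 \<le> k \<Longrightarrow> 0 < k"
    "\<And>k. k0 \<le> k \<Longrightarrow> B / real k < 1 / 2"
    "\<And>k. k0 \<le> k \<Longrightarrow> B / real k \<le> c * (M0 / 2) powr \<mu> * real k powr (-\<tau> - \<mu> * \<rho>)"
    "\<And>k. k0 \<le> k \<Longrightarrow> a (Suc k) \<le> a k
        - min (a k / 2) (c * a k powr (1 + \<mu>) * real k powr (-\<tau>))
        + A / real k * (a k + real k powr (-\<tau>))"
    using eventually_conj[OF eventually_gt_at_top[of 0] eventually_conj[OF evB eventually_conj[OF evM rec]]]
    unfolding eventually_sequentially by blast
  \<comment> \<open>\<open>k0\<close> depends on \<open>M0\<close> but not on \<open>M\<close>, so \<open>M\<close> may be enlarged to cover the base case.\<close>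
  define M where "M = max M0 (max 2 (a k0 * real k0 powr \<rho>))"
  have M: "M0 \<le> M" "2 \<le> M" "a k0 * real k0 powr \<rho> \<le> M" by (auto simp: M_def)
  have bound: "a k \<le> M * real k powr (-\<rho>)" if "k0 \<le> k" for k
    using that
  proof (induction k rule: dec_induct)
    case base
    have "a k0 = (a k0 * real k0 powr \<rho>) * real k0 powr (-\<rho>)"
      using k0(1)[of k0] by (simp add: powr_minus)
    also have "\<dots> \<le> M * real k0 powr (-\<rho>)" using M by (intro mult_right_mono) auto
    finally show ?case .
  next
    case (step k)
    define b where "b = real k powr (-\<rho>)"
    have k: "0 < real k" "1 \<le> real k" using k0(1)[OF step(1)] by auto
    have b: "0 < b" using k by (simp add: b_def)
    have tb: "real k powr (-\<tau>) \<le> b" using k rho by (simp add: b_def powr_mono)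
    have Bk: "A / real k + \<rho> / real k \<le> 1 / 2"
    proof -
      have "(A + \<rho>) / real k \<le> B / real k"
        using A k by (intro divide_right_mono) (auto simp: B_def)
      then show ?thesis using k0(2)[OF step(1)] unfolding add_divide_distrib by linarith
    qed
    have Ak: "0 \<le> A / real k" "0 \<le> \<rho> / real k" using A rho k by auto
    have "a (Suc k) \<le> (M * b) * (1 - \<rho> / real k)"
    \<comment> \<open>In the lower half the descent is dropped: \<open>2 \<le> M\<close> bounds the
      power of \<open>k\<close> by \<open>M / 2 * b\<close>, and the free factor 1/2 absorbs
      \<open>A / k + \<rho> / k\<close>.\<close>
    proof (cases "a k \<le> M / 2 * b")
      case True
      have "0 \<le> min (a k / 2) (c * a k powr (1 + \<mu>) * real k powr (-\<tau>))"
        using nonneg[of k] c by simp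
      then have "a (Suc k) \<le> a k + A / real k * (a k + real k powr (-\<tau>))"
        using k0(4)[OF step(1)] by linarith
      also have "\<dots> \<le> M / 2 * b + A / real k * (M / 2 * b + M / 2 * b)"
      proof (intro add_mono mult_left_mono)
        have "1 * b \<le> M / 2 * b" using M b by (intro mult_right_mono) auto
        then show "real k powr (-\<tau>) \<le> M / 2 * b" using tb by simp
      qed (use True Ak in auto)
      also have "\<dots> = (M * b) * (1 / 2 + A / real k)" by (simp add: algebra_simps)
      also have "\<dots> \<le> (M * b) * (1 - \<rho> / real k)"
      proof (rule mult_left_mono)
        show "1 / 2 + A / real k \<le> 1 - \<rho> / real k" using Bk by linarith
      qed (use M b in auto)
      finally show ?thesis .
    next
      case False
      have Mb: "b \<le> M / 2 * b" using M b by simp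
      have ak: "0 < a k" using False Mb b by linarith
      have tk: "real k powr (-\<tau>) \<le> a k" using False Mb tb by linarith
      \<comment> \<open>In the upper half \<open>a k\<close> exceeds \<open>M0 / 2 * b\<close>, so
        the choice of \<open>M0\<close> applies to one branch of the minimum and
        \<open>B / k < 1 / 2\<close> to the other.\<close>
      have Ba: "B / real k * a k \<le> min (a k / 2) (c * a k powr (1 + \<mu>) * real k powr (-\<tau>))"
      proof (rule min.boundedI)
        have "B / real k * a k \<le> 1 / 2 * a k"
          using k0(2)[OF step(1)] ak by (intro mult_right_mono) auto
        then show "B / real k * a k \<le> a k / 2" by simp
        have "(M0 / 2) powr \<mu> * real k powr (- \<mu> * \<rho>) = (M0 / 2 * b) powr \<mu>"
          using M0 b powr_mult[of "M0 / 2" b \<mu>] by (simp add: b_def powr_powr mult.commute)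
        also have "\<dots> \<le> a k powr \<mu>"
        proof (rule powr_mono2)
          have "M0 / 2 * b \<le> M / 2 * b" using M b by (intro mult_right_mono) auto
          then show "M0 / 2 * b \<le> a k" using False by linarith
        qed (use mu M0 b in auto)
        finally have le: "(M0 / 2) powr \<mu> * real k powr (- \<mu> * \<rho>) \<le> a k powr \<mu>" .
        have "B / real k * a k
            \<le> c * (M0 / 2) powr \<mu> * real k powr (-\<tau> - \<mu> * \<rho>) * a k"
          using k0(3)[OF step(1)] ak by (intro mult_right_mono) auto
        also have "\<dots> = c * ((M0 / 2) powr \<mu> * real k powr (- \<mu> * \<rho>)) * a k * real k powr (-\<tau>)"
        proof -
          have "real k powr (-\<tau> - \<mu> * \<rho>) = real k powr (- \<mu> * \<rho>) * real k powr (-\<tau>)"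
            by (subst powr_add[symmetric]) (simp add: algebra_simps)
          then show ?thesis by (simp only: mult_ac)
        qed
        also have "\<dots> \<le> c * a k powr \<mu> * a k * real k powr (-\<tau>)"
          using le c ak by (intro mult_right_mono mult_left_mono) auto
        also have "\<dots> = c * a k powr (1 + \<mu>) * real k powr (-\<tau>)"
          using ak by (simp add: powr_add mult_ac)
        finally show "B / real k * a k \<le> c * a k powr (1 + \<mu>) * real k powr (-\<tau>)" .
      qed
      have "A / real k * (a k + real k powr (-\<tau>)) \<le> A / real k * (a k + a k)"
        using tk Ak by (intro mult_left_mono) auto
      then have "a (Suc k) \<le> a k - B / real k * a k + A / real k * (a k + a k)"
        using k0(4)[OF step(1)] Ba by linarith
      also have "\<dots> = a k * (1 - \<rho> / real k)"
        using k by (simp add: B_def field_simps)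
      also have "\<dots> \<le> (M * b) * (1 - \<rho> / real k)"
      proof (rule mult_right_mono)
        show "0 \<le> 1 - \<rho> / real k" using Bk Ak by linarith
      qed (use step.IH in \<open>simp add: b_def\<close>)
      finally show ?thesis .
    qed
    also have "\<dots> = M * (real k powr (-\<rho>) * (1 - \<rho> / real k))" by (simp add: b_def)
    also have "\<dots> \<le> M * real (Suc k) powr (-\<rho>)"
      using powr_minus_Suc_ge[of k \<rho>] k M rho by (intro mult_left_mono) auto
    finally show ?case .
  qed
  show ?thesis
    using bound nonneg by (intro bigoI[of _ M] eventually_sequentiallyI[of k0]) auto
qed

text \<open>The step length is at most \<open>G / (L * d\<^sup>2)\<close>, so the quadratic loss is
  at most half of the linear gain \<open>\<alpha> * G\<close>, and this gain equals the minimum on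
  the left.\<close>

lemma short_step_decrease:
  fixes G L d :: real
  assumes "0 \<le> G" "0 < L" "0 \<le> d" "\<alpha> = (if G = 0 \<and> d = 0 then 0 else min 1 (G / (L * d\<^sup>2)))"
  shows "min G (G\<^sup>2 / (L * d\<^sup>2)) / 2 \<le> \<alpha> * G - L / 2 * \<alpha>\<^sup>2 * d\<^sup>2"
proof (cases "d = 0")
  \<comment> \<open>Division by zero yields 0, so the step and both sides vanish.\<close>
  case True
  then show ?thesis using assms by auto
next
  case False
  define Q m where "Q = L * d\<^sup>2" and "m = min G (G\<^sup>2 / (L * d\<^sup>2))"
  have Q: "0 < Q" using False assms by (simp add: Q_def)
  have \<alpha>: "\<alpha> = min 1 (G / Q)" using assms False by (simp add: Q_def)
  have \<alpha>0: "0 \<le> \<alpha>" using \<alpha> Q assms by simp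
  have "\<alpha> * Q \<le> G" using \<alpha> Q by (simp add: min_def field_simps split: if_splits)
  then have "\<alpha> * (\<alpha> * Q) \<le> \<alpha> * G" using \<alpha>0 by (rule mult_left_mono)
  moreover have "\<alpha> * G = m"
    using \<alpha> assms(1) by (simp add: m_def Q_def min_mult_distrib_right power2_eq_square)
  moreover have "L / 2 * \<alpha>\<^sup>2 * d\<^sup>2 = \<alpha> * (\<alpha> * Q) / 2"
    by (simp add: Q_def power2_eq_square)
  ultimately show ?thesis unfolding m_def[symmetric] by linarith
qed

subsection \<open>Augmented Lagrangian estimates\<close>

lemma edom_ind_fun [simp]: "edom (ind_fun C) = C"
  by (auto simp: edom_def ind_fun_def)

lemma lin_argmin_ind_fun:
  assumes "v \<in> lin_argmin (ind_fun C) u" "C \<noteq> {}"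
  shows "v \<in> C" "\<And>w. w \<in> C \<Longrightarrow> u \<bullet> v \<le> u \<bullet> w"
proof -
  have le: "ereal (v \<bullet> u) + ind_fun C v \<le> ereal (w \<bullet> u) + ind_fun C w" for w
    using assms(1) by (simp add: lin_argmin_def is_arg_min_def not_less)
  obtain y where y: "y \<in> C" using assms(2) by blast
  show vC: "v \<in> C"
    using le[of y] y by (auto simp: ind_fun_def split: if_splits)
  show "u \<bullet> v \<le> u \<bullet> w" if "w \<in> C" for w
    using le[of w] that vC by (simp add: ind_fun_def inner_commute)
qed

lemma norm_vec_square: "(norm (w :: real^'m))\<^sup>2 = (\<Sum>i\<in>UNIV. (w $ i)\<^sup>2)"
  unfolding power2_norm_eq_inner by (simp add: inner_vec_def power2_eq_square)

text \<open>The gradient inequalities of \<open>f\<close> and of the constraints, weighted by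
  \<open>zs\<close>, are added to the normal cone inequality for \<open>s\<close>. Stationarity
  cancels the linear terms and complementarity removes \<open>zs \<bullet> g xs\<close>.\<close>

lemma kkt_saddle:
  assumes "convex_program f (ind_fun C) g Lf D Lg B" "C \<noteq> {}"
  obtains xs zs where "xs \<in> C" "g xs \<le> 0" "0 \<le> zs" "\<And>y. y \<in> C \<Longrightarrow> f xs \<le> f y + zs \<bullet> g y"
proof -
  interpret convex_program f "ind_fun C" g Lf D Lg B by fact
  obtain xs zs s where s: "s \<in> subdiff (ind_fun C) xs"
    and eq: "grad f xs + s + (\<Sum>i\<in>UNIV. zs $ i *\<^sub>R grad (\<lambda>y. g y $ i) xs) = 0"
    and feas: "g xs \<le> 0" "0 \<le> zs" and comp: "zs \<bullet> g xs = 0"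
    using kkt_ex unfolding kkt_point_def by blast
  have sub: "ind_fun C xs + ereal (s \<bullet> (y - xs)) \<le> ind_fun C y" for y
    using s by (simp add: subdiff_def)
  \<comment> \<open>Outside \<open>C\<close> the indicator is infinite, which contradicts the
    subgradient inequality at any point of \<open>C\<close>.\<close>
  have xs: "xs \<in> C"
    using sub assms(2) by (force simp: ind_fun_def split: if_splits)
  have "f xs \<le> f y + zs \<bullet> g y" if y: "y \<in> C" for y
  proof -
    have "s \<bullet> (y - xs) \<le> 0" using sub[of y] y xs by (simp add: ind_fun_def)
    moreover have "f xs + grad f xs \<bullet> (y - xs) \<le> f y"
      by (rule convex_gradient_inequality[OF f_convex f_diff])
    moreover have "(\<Sum>i\<in>UNIV. zs $ i * (g xs $ i + grad (\<lambda>y. g y $ i) xs \<bullet> (y - xs)))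
        \<le> (\<Sum>i\<in>UNIV. zs $ i * g y $ i)"
      using feas(2) convex_gradient_inequality[OF g_convex g_diff]
      by (intro sum_mono mult_left_mono) (auto simp: less_eq_vec_def)
    moreover have "(grad f xs + s + (\<Sum>i\<in>UNIV. zs $ i *\<^sub>R grad (\<lambda>y. g y $ i) xs)) \<bullet> (y - xs) = 0"
      by (simp add: eq)
    moreover have "(\<Sum>i\<in>UNIV. zs $ i * g xs $ i) = 0" "(\<Sum>i\<in>UNIV. zs $ i * g y $ i) = zs \<bullet> g y"
      using comp by (simp_all add: inner_vec_def)
    ultimately show ?thesis
      by (simp add: inner_add_left inner_sum_left sum.distrib distrib_left)
  qed
  then show ?thesis using that xs feas by blast
qed

text \<open>Fixing a saddle point here makes the optimal value the real number \<open>f xs\<close>,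
  so that the estimates stay free of infinite values.\<close>

locale al_fw_run = convex_program f "ind_fun C" g Lf D Lg B
  for f :: "real^'n \<Rightarrow> real" and C and g :: "real^'n \<Rightarrow> real^'m" and Lf D Lg B +
  fixes \<nu> q :: real and lam \<sigma> \<alpha> :: "nat \<Rightarrow> real" and x v :: "nat \<Rightarrow> real^'n"
    and z :: "nat \<Rightarrow> real^'m" and xs :: "real^'n" and zs :: "real^'m"
  assumes C_compact: "compact C"
    and C_unif: "uniformly_convex_set \<nu> q C"
    and run: "al_fw_sequence f (ind_fun C) g lam \<sigma> \<alpha> x z v"
    and alpha: "\<And>k. \<alpha> k = short_step f (ind_fun C) g Lf Lg B (x k) (z k) (v k) (lam k)"
    and xs_in: "xs \<in> C" and xs_feas: "g xs \<le> 0" and zs_nonneg: "0 \<le> zs"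
    and saddle: "\<And>y. y \<in> C \<Longrightarrow> f xs \<le> f y + zs \<bullet> g y"
begin

text \<open>The multiplier that turns the gradient of the augmented Lagrangian into that of the
  Lagrangian. The iterate \<open>z (Suc k)\<close> differs from it in general: its step is \<sigma>
  and it uses the new point.\<close>

abbreviation new_mult :: "real \<Rightarrow> real^'n \<Rightarrow> real^'m \<Rightarrow> 'm \<Rightarrow> real" where
  "new_mult l y w i \<equiv> pos_part (l * g y $ i + w $ i)"

definition subopt :: "real \<Rightarrow> real^'n \<Rightarrow> real^'m \<Rightarrow> real" where
  "subopt l y w = F_al f g l y w - f xs"

lemma F_al_eq: "F_al f g l y w = f y + (\<Sum>i\<in>UNIV. al_pen l (w $ i) (g y $ i))"
  by (simp add: F_al_def Psi_eq_sum_al_pen)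

lemma grad_F_eq:
  assumes "0 < l"
  shows "grad_F f g l y w = grad f y + (\<Sum>i\<in>UNIV. new_mult l y w i *\<^sub>R grad (\<lambda>y. g y $ i) y)"
proof -
  have f': "(f has_derivative (\<lambda>h. h \<bullet> grad f y)) (at y)"
    using GDERIV_grad[OF f_diff] by (simp add: gderiv_def)
  have g': "((\<lambda>y. al_pen l (w $ i) (g y $ i)) has_derivative
      (\<lambda>h. new_mult l y w i * (h \<bullet> grad (\<lambda>y. g y $ i) y))) (at y)" for i
  proof -
    have "((\<lambda>y. g y $ i) has_derivative (\<lambda>h. h \<bullet> grad (\<lambda>y. g y $ i) y)) (at y)"
      using GDERIV_grad[OF g_diff] by (simp add: gderiv_def)
    moreover have "(al_pen l (w $ i) has_derivative (\<lambda>h. new_mult l y w i * h)) (at (g y $ i))"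
      using al_pen_DERIV[OF assms] by (simp add: has_field_derivative_def)
    ultimately show ?thesis by (rule has_derivative_compose)
  qed
  have "((\<lambda>y. F_al f g l y w) has_derivative (\<lambda>h. h \<bullet> grad f y +
      (\<Sum>i\<in>UNIV. new_mult l y w i * (h \<bullet> grad (\<lambda>y. g y $ i) y)))) (at y)"
    unfolding F_al_eq by (intro has_derivative_add has_derivative_sum f' g')
  then have "GDERIV (\<lambda>y. F_al f g l y w) y :>
      (grad f y + (\<Sum>i\<in>UNIV. new_mult l y w i *\<^sub>R grad (\<lambda>y. g y $ i) y))"
    by (simp add: gderiv_def inner_add_right inner_sum_right)
  then show ?thesis unfolding grad_F_def by (rule grad_eqI)
qed

lemma C_convex: "convex C" and q_ge: "2 \<le> q" and nu_pos: "0 < \<nu>"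
  using C_unif by (auto simp: uniformly_convex_set_def)

text \<open>Convexity of the augmented Lagrangian in \<open>y\<close>: the penalty has nonnegative
  slope \<open>new_mult\<close>, so the gradient inequalities of the constraints may be multiplied
  by it.\<close>

lemma F_al_tangent_le:
  assumes "0 < l"
  shows "F_al f g l y w + grad_F f g l y w \<bullet> (y' - y) \<le> F_al f g l y' w"
proof -
  have "f y + grad f y \<bullet> (y' - y) \<le> f y'"
    by (rule convex_gradient_inequality[OF f_convex f_diff])
  moreover have "(\<Sum>i\<in>UNIV. al_pen l (w $ i) (g y $ i) + new_mult l y w i * (grad (\<lambda>y. g y $ i) y \<bullet> (y' - y)))
      \<le> (\<Sum>i\<in>UNIV. al_pen l (w $ i) (g y' $ i))"
  proof (rule sum_mono)
    fix i
    have "new_mult l y w i * (grad (\<lambda>y. g y $ i) y \<bullet> (y' - y)) \<le> new_mult l y w i * (g y' $ i - g y $ i)"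
      using convex_gradient_inequality[OF g_convex g_diff, of y i y'] by (intro mult_left_mono) auto
    then show "al_pen l (w $ i) (g y $ i) + new_mult l y w i * (grad (\<lambda>y. g y $ i) y \<bullet> (y' - y))
        \<le> al_pen l (w $ i) (g y' $ i)"
      using al_pen_tangent_le[OF assms, of "w $ i" "g y $ i" "g y' $ i"] by linarith
  qed
  ultimately show ?thesis
    by (simp add: F_al_eq grad_F_eq[OF assms] inner_add_left inner_sum_left sum.distrib)
qed

text \<open>The two parts of \<open>L_Psi\<close> have separate sources: the curvature
  \<open>l\<close> of the penalty times the squared Lipschitz constant of the constraint, and the
  curvature of the constraint times its multiplier at \<open>y\<close>.\<close>

lemma F_al_quadratic_upper:
  assumes l: "0 < l" and y: "y \<in> C" "y' \<in> C"
  shows "F_al f g l y' w \<le> F_al f g l y w + grad_F f g l y w \<bullet> (y' - y)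
    + (L_Psi g Lg B l y w + Lf) / 2 * (norm (y' - y))\<^sup>2"
proof -
  have "f y' \<le> f y + grad f y \<bullet> (y' - y) + Lf / 2 * (norm (y' - y))\<^sup>2"
    by (rule lipschitz_gradient_upper[OF convex_UNIV _ _ f_diff f_smooth]) auto
  moreover have "(\<Sum>i\<in>UNIV. al_pen l (w $ i) (g y' $ i))
      \<le> (\<Sum>i\<in>UNIV. al_pen l (w $ i) (g y $ i) + new_mult l y w i * (grad (\<lambda>y. g y $ i) y \<bullet> (y' - y))
          + (l * (B i)\<^sup>2 + Lg i * new_mult l y w i) * ((norm (y' - y))\<^sup>2 / 2))"
  proof (rule sum_mono)
    fix i
    have "g y' $ i \<le> g y $ i + grad (\<lambda>y. g y $ i) y \<bullet> (y' - y) + Lg i / 2 * (norm (y' - y))\<^sup>2"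
      using lipschitz_gradient_upper[OF C_convex y g_diff] g_smooth[of i] by simp
    then have "new_mult l y w i * (g y' $ i - g y $ i)
        \<le> new_mult l y w i * (grad (\<lambda>y. g y $ i) y \<bullet> (y' - y) + Lg i / 2 * (norm (y' - y))\<^sup>2)"
      by (intro mult_left_mono) auto
    moreover have "l / 2 * (g y' $ i - g y $ i)\<^sup>2 \<le> l / 2 * ((B i)\<^sup>2 * (norm (y' - y))\<^sup>2)"
    proof (intro mult_left_mono)
      have "\<bar>g y' $ i - g y $ i\<bar> \<le> B i * norm (y' - y)"
        using lipschitz_onD[OF g_lipschitz[of i], of y' y] y by (simp add: dist_norm)
      then have "\<bar>g y' $ i - g y $ i\<bar>\<^sup>2 \<le> (B i * norm (y' - y))\<^sup>2"
        by (intro power_mono) auto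
      then show "(g y' $ i - g y $ i)\<^sup>2 \<le> (B i)\<^sup>2 * (norm (y' - y))\<^sup>2"
        by (simp add: power_mult_distrib)
    qed (use l in auto)
    ultimately show "al_pen l (w $ i) (g y' $ i) \<le> al_pen l (w $ i) (g y $ i)
        + new_mult l y w i * (grad (\<lambda>y. g y $ i) y \<bullet> (y' - y))
        + (l * (B i)\<^sup>2 + Lg i * new_mult l y w i) * ((norm (y' - y))\<^sup>2 / 2)"
      using al_pen_quadratic_upper[OF l, of "w $ i" "g y' $ i" "g y $ i"]
      by (simp add: algebra_simps)
  qed
  moreover have "\<dots> = (\<Sum>i\<in>UNIV. al_pen l (w $ i) (g y $ i))
      + (\<Sum>i\<in>UNIV. new_mult l y w i * (grad (\<lambda>y. g y $ i) y \<bullet> (y' - y)))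
      + L_Psi g Lg B l y w / 2 * (norm (y' - y))\<^sup>2"
  proof -
    have "(\<Sum>i\<in>UNIV. (l * (B i)\<^sup>2 + Lg i * new_mult l y w i) * ((norm (y' - y))\<^sup>2 / 2))
        = L_Psi g Lg B l y w / 2 * (norm (y' - y))\<^sup>2"
      unfolding L_Psi_def sum_distrib_right[symmetric] by simp
    then show ?thesis by (subst sum.distrib, subst sum.distrib) (simp only:)
  qed
  ultimately show ?thesis
    unfolding F_al_eq grad_F_eq[OF l] inner_add_left inner_sum_left inner_scaleR_left
      add_divide_distrib distrib_right by linarith
qed

section \<open>Infeasibility and objective error in terms of the suboptimality\<close>

lemma al_pen_sum_le_subopt:
  assumes "y \<in> C"
  shows "(\<Sum>i\<in>UNIV. al_pen l (w $ i) (g y $ i) - zs $ i * g y $ i) \<le> subopt l y w"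
  using saddle[OF assms] by (simp add: subopt_def F_al_eq inner_vec_def sum_subtractf)

text \<open>Dividing by \<open>l\<close> gains a factor \<open>1 / l\<close> for the squared
  infeasibility, the quantity that a change of the parameters costs.\<close>

lemma infeasibility_square_le:
  assumes l: "0 < l" and y: "y \<in> C"
  shows "l / 4 * (\<Sum>i\<in>UNIV. (pos_part (g y $ i))\<^sup>2) \<le> subopt l y w + (norm (zs - w))\<^sup>2 / l"
proof -
  have "l / 4 * (\<Sum>i\<in>UNIV. (pos_part (g y $ i))\<^sup>2) - (norm (zs - w))\<^sup>2 / l
      = (\<Sum>i\<in>UNIV. l / 4 * (pos_part (g y $ i))\<^sup>2 - (zs $ i - w $ i)\<^sup>2 / l)"
    by (simp add: sum_distrib_left sum_subtractf norm_vec_square sum_divide_distrib)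
  also have "\<dots> \<le> (\<Sum>i\<in>UNIV. al_pen l (w $ i) (g y $ i) - zs $ i * g y $ i)"
  proof (rule sum_mono)
    fix i
    define s where "s = g y $ i"
    define p where "p = pos_part s"
    have p: "p * s = p\<^sup>2" by (simp add: p_def pos_part_def max_def power2_eq_square)
    have "0 \<le> zs $ i + l / 2 * p" using zs_nonneg l by (simp add: less_eq_vec_def p_def)
    \<comment> \<open>\<open>zs $ i + l / 2 * p\<close> balances the gain \<open>l / 2 * p\<^sup>2\<close> against half of it lost to the square.\<close>
    from al_pen_ge[OF l this, of s "w $ i"]
    have "(zs $ i + l / 2 * p) * s - (zs $ i + l / 2 * p - w $ i)\<^sup>2 / (2 * l) \<le> al_pen l (w $ i) s" .
    moreover have "(zs $ i + l / 2 * p) * s = zs $ i * s + l / 2 * p\<^sup>2"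
      by (simp add: distrib_right p mult.assoc)
    moreover have "(zs $ i + l / 2 * p - w $ i)\<^sup>2 / (2 * l) \<le> (zs $ i - w $ i)\<^sup>2 / l + l / 4 * p\<^sup>2"
    proof -
      have "0 \<le> ((zs $ i - w $ i) - l / 2 * p)\<^sup>2 / (2 * l)" using l by simp
      also have "\<dots> = (zs $ i - w $ i)\<^sup>2 / l + l / 4 * p\<^sup>2 - (zs $ i + l / 2 * p - w $ i)\<^sup>2 / (2 * l)"
        using l by (simp add: field_simps power2_eq_square)
      finally show ?thesis by simp
    qed
    ultimately show "l / 4 * (pos_part (g y $ i))\<^sup>2 - (zs $ i - w $ i)\<^sup>2 / l
        \<le> al_pen l (w $ i) (g y $ i) - zs $ i * g y $ i"
      unfolding s_def[symmetric] p_def[symmetric] by linarith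
  qed
  also have "\<dots> \<le> subopt l y w" by (rule al_pen_sum_le_subopt[OF y])
  finally show ?thesis by linarith
qed

lemma infeasibility_le:
  assumes l: "0 < l" and y: "y \<in> C"
  shows "(\<Sum>i\<in>UNIV. pos_part (g y $ i)) \<le> subopt l y w + ((norm (zs - w))\<^sup>2 + real CARD('m)) / l"
proof -
  have "(\<Sum>i\<in>UNIV. pos_part (g y $ i)) - ((norm (zs - w))\<^sup>2 + real CARD('m)) / l
      = (\<Sum>i\<in>UNIV. pos_part (g y $ i) - ((zs $ i - w $ i)\<^sup>2 + 1) / l)"
    by (simp add: sum_subtractf norm_vec_square sum_divide_distrib[symmetric] sum.distrib)
  also have "\<dots> \<le> (\<Sum>i\<in>UNIV. al_pen l (w $ i) (g y $ i) - zs $ i * g y $ i)"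
  proof (rule sum_mono)
    fix i
    \<comment> \<open>Raising \<open>zs $ i\<close> by one exactly on violated constraints makes the
      infeasibility appear to the first power.\<close>
    define s e where "s = g y $ i" and "e = (if 0 < s then 1 else 0 :: real)"
    have p: "e * s = pos_part s" by (simp add: e_def pos_part_def)
    have e: "0 \<le> e" "e\<^sup>2 \<le> 1" by (auto simp: e_def)
    have "0 \<le> zs $ i + e" using zs_nonneg e by (simp add: less_eq_vec_def)
    from al_pen_ge[OF l this, of s "w $ i"]
    have "(zs $ i + e) * s - (zs $ i + e - w $ i)\<^sup>2 / (2 * l) \<le> al_pen l (w $ i) s" .
    moreover have "(zs $ i + e) * s = zs $ i * s + pos_part s"
      by (simp add: distrib_right p)
    moreover have "(zs $ i + e - w $ i)\<^sup>2 / (2 * l) \<le> ((zs $ i - w $ i)\<^sup>2 + 1) / l"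
    proof -
      have "0 \<le> ((zs $ i - w $ i) - e)\<^sup>2" by simp
      then have "(zs $ i + e - w $ i)\<^sup>2 \<le> 2 * ((zs $ i - w $ i)\<^sup>2 + 1)"
        using e by (simp add: power2_eq_square algebra_simps)
      then show ?thesis using l by (simp add: field_simps)
    qed
    ultimately show "pos_part (g y $ i) - ((zs $ i - w $ i)\<^sup>2 + 1) / l
        \<le> al_pen l (w $ i) (g y $ i) - zs $ i * g y $ i"
      unfolding s_def[symmetric] by linarith
  qed
  also have "\<dots> \<le> subopt l y w" by (rule al_pen_sum_le_subopt[OF y])
  finally show ?thesis by linarith
qed

lemma F_al_xs_le:
  assumes "0 < l" "0 \<le> w"
  shows "F_al f g l xs w \<le> f xs"
proof -
  have "(\<Sum>i\<in>UNIV. al_pen l (w $ i) (g xs $ i)) \<le> 0"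
    using assms xs_feas by (intro sum_nonpos al_pen_nonpos) (auto simp: less_eq_vec_def)
  then show ?thesis by (simp add: F_al_eq)
qed

lemma opt_value_eq: "opt_value f (ind_fun C) g = ereal (f xs)"
  unfolding opt_value_def
proof (rule INF_eqI)
  fix y assume y: "y \<in> {x. g x \<le> 0}"
  show "ereal (f xs) \<le> ereal (f y) + ind_fun C y"
  proof (cases "y \<in> C")
    case True
    have "zs \<bullet> g y \<le> 0"
      using y zs_nonneg by (auto simp: inner_vec_def less_eq_vec_def intro!: sum_nonpos mult_nonneg_nonpos)
    then show ?thesis using saddle[OF True] True by (simp add: ind_fun_def)
  qed (simp add: ind_fun_def)
next
  fix u assume "\<And>y. y \<in> {x. g x \<le> 0} \<Longrightarrow> u \<le> ereal (f y) + ind_fun C y"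
  from this[of xs] show "u \<le> ereal (f xs)" using xs_in xs_feas by (simp add: ind_fun_def)
qed

text \<open>The objective error is bounded below by the saddle inequality, which costs the factor
  \<open>norm zs\<close>, and above by testing the penalty with multiplier 0. The infeasibility
  comes from \<open>infeasibility_le\<close>.\<close>

lemma residual_le:
  assumes l: "0 < l" and y: "y \<in> C"
  shows "residual f (ind_fun C) g y \<le>
    (1 + norm zs) * (max 0 (subopt l y w) + ((norm (zs - w))\<^sup>2 + (norm w)\<^sup>2 + real CARD('m)) / l)"
proof -
  define r where "r = max 0 (subopt l y w) + ((norm (zs - w))\<^sup>2 + (norm w)\<^sup>2 + real CARD('m)) / l"
  have r0: "0 \<le> r" using l by (simp add: r_def)
  have "norm (pos_part_vec (g y)) \<le> (\<Sum>i\<in>UNIV. \<bar>pos_part_vec (g y) $ i\<bar>)"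
    by (rule norm_le_l1_cart)
  also have "\<dots> = (\<Sum>i\<in>UNIV. pos_part (g y $ i))" by (simp add: pos_part_vec_def)
  also have "\<dots> \<le> subopt l y w + ((norm (zs - w))\<^sup>2 + real CARD('m)) / l"
    by (rule infeasibility_le[OF l y])
  also have "\<dots> \<le> r"
    unfolding r_def using l by (intro add_mono divide_right_mono) auto
  finally have inf: "norm (pos_part_vec (g y)) \<le> r" .
  have "zs \<bullet> g y \<le> zs \<bullet> pos_part_vec (g y)"
    using zs_nonneg by (auto simp: inner_vec_def less_eq_vec_def pos_part_vec_def pos_part_ge
        intro!: sum_mono mult_left_mono)
  also have "\<dots> \<le> norm zs * norm (pos_part_vec (g y))" by (rule norm_cauchy_schwarz)
  also have "\<dots> \<le> norm zs * r" using inf by (intro mult_left_mono) auto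
  finally have lo: "f xs - f y \<le> norm zs * r" using saddle[OF y] by linarith
  have "(\<Sum>i\<in>UNIV. - ((w $ i)\<^sup>2 / (2 * l))) \<le> (\<Sum>i\<in>UNIV. al_pen l (w $ i) (g y $ i))"
    by (intro sum_mono al_pen_ge_neg l)
  then have "f y - f xs \<le> subopt l y w + (norm w)\<^sup>2 / (2 * l)"
    by (simp add: subopt_def F_al_eq sum_negf norm_vec_square sum_divide_distrib)
  also have "\<dots> \<le> r"
    unfolding r_def using l by (intro add_mono frac_le) auto
  finally have hi: "f y - f xs \<le> r" .
  have zr: "0 \<le> norm zs * r" using r0 by simp
  have "\<bar>f y - f xs\<bar> \<le> (1 + norm zs) * r" "norm (pos_part_vec (g y)) \<le> (1 + norm zs) * r"
    using lo hi inf r0 zr unfolding distrib_right abs_le_iff by linarith+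
  then show ?thesis
    unfolding residual_def opt_value_eq r_def[symmetric] using y by (simp add: ind_fun_def)
qed

end

subsection \<open>The iterates\<close>

context al_fw_run
begin

abbreviation "u k \<equiv> grad_F f g (lam k) (x k) (z k)"
abbreviation "L k \<equiv> L_Psi g Lg B (lam k) (x k) (z k) + Lf"

lemma C_nonempty: "C \<noteq> {}"
  using xs_in by blast

lemma lam_pos: "0 < lam k"
  and sigma_pos: "0 < \<sigma> k" and sigma_le: "\<sigma> k \<le> lam k"
  and lam_less_Suc: "lam k < lam (Suc k)"
  and sigma_summable: "summable \<sigma>"
  and lam_at_top: "filterlim lam at_top sequentially"
  and alpha_bounds: "0 \<le> \<alpha> k" "\<alpha> k \<le> 1"
  and x0: "x 0 \<in> C" and z0: "0 \<le> z 0"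
  and v_argmin: "v k \<in> lin_argmin (ind_fun C) (u k)"
  and x_Suc: "x (Suc k) = x k + \<alpha> k *\<^sub>R (v k - x k)"
  and z_Suc: "z (Suc k) = z k + \<sigma> k *\<^sub>R (\<chi> i. max (- (z k $ i) / lam k) (g (x (Suc k)) $ i))"
  using run unfolding al_fw_sequence_def by auto

lemmas v_in = lin_argmin_ind_fun(1)[OF v_argmin C_nonempty]
lemmas v_min = lin_argmin_ind_fun(2)[OF v_argmin C_nonempty]

lemma lam_ge: "lam 0 \<le> lam k"
  by (induction k) (use lam_less_Suc less_imp_le order_trans in \<open>blast+\<close>)

lemma x_in: "x k \<in> C"
proof (induction k)
  case (Suc k)
  have "x (Suc k) = (1 - \<alpha> k) *\<^sub>R x k + \<alpha> k *\<^sub>R v k"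
    by (simp add: x_Suc algebra_simps)
  then show ?case using convexD_alt[OF C_convex Suc v_in alpha_bounds] by simp
qed (rule x0)

text \<open>Since \<sigma> never exceeds \<open>lam\<close>, an update removes at most the current
  multiplier.\<close>

lemma z_nonneg: "0 \<le> z k $ i"
proof (induction k)
  case (Suc k)
  have "\<sigma> k / lam k * z k $ i \<le> 1 * z k $ i"
    using sigma_le[of k] lam_pos[of k] Suc by (intro mult_right_mono) auto
  then have "0 \<le> z k $ i + \<sigma> k * (- (z k $ i) / lam k)" by simp
  also have "\<dots> \<le> z k $ i + \<sigma> k * max (- (z k $ i) / lam k) (g (x (Suc k)) $ i)"
    using sigma_pos[of k] by (intro add_left_mono mult_left_mono) auto
  also have "\<dots> = z (Suc k) $ i" by (simp add: z_Suc)
  finally show ?case .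
qed (use z0 in \<open>simp add: less_eq_vec_def\<close>)

section \<open>Uniform bounds along the run\<close>

lemma g_bounded:
  obtains Gb where "0 \<le> Gb" "\<And>y i. y \<in> C \<Longrightarrow> \<bar>g y $ i\<bar> \<le> Gb"
proof -
  have "continuous_on C g"
    using continuous_on_subset[OF lipschitz_on_continuous_on[OF g_lipschitz]]
    by (intro continuous_on_vec_lambda[of C "\<lambda>i y. g y $ i", simplified]) auto
  then have "bounded (g ` C)"
    using C_compact compact_continuous_image compact_imp_bounded by blast
  then obtain b where b: "\<And>y. y \<in> C \<Longrightarrow> norm (g y) \<le> b"
    by (auto simp: bounded_iff)
  have "\<bar>g y $ i\<bar> \<le> max b 0" if "y \<in> C" for y i
    using b[OF that] component_le_norm_cart[of "g y" i] by linarith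
  then show ?thesis using that[of "max b 0"] by auto
qed

text \<open>Each update adds at most \<open>\<sigma> k * Gb\<close> to a component and \<sigma> is
  summable. One constant serves all the bounds used later.\<close>

lemma z_bounded:
  obtains Z where "0 \<le> Z" "\<And>k i. z k $ i \<le> Z" "\<And>k. norm (z k) \<le> Z" "\<And>k. (norm (zs - z k))\<^sup>2 \<le> Z"
proof -
  obtain Gb where Gb: "0 \<le> Gb" "\<And>y i. y \<in> C \<Longrightarrow> \<bar>g y $ i\<bar> \<le> Gb" by (rule g_bounded) blast
  have le: "z k $ i \<le> z 0 $ i + Gb * (\<Sum>j<k. \<sigma> j)" for k i
  proof (induction k)
    case (Suc k)
    have "0 \<le> z k $ i / lam k" using z_nonneg[of k i] lam_pos[of k] by simp
    then have "- (z k $ i) / lam k \<le> Gb" using Gb(1) by simp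
    moreover have "g (x (Suc k)) $ i \<le> Gb" using Gb(2)[OF x_in] by (rule abs_le_D1)
    ultimately have "z (Suc k) $ i \<le> z k $ i + \<sigma> k * Gb"
      using sigma_pos[of k] by (simp add: z_Suc)
    then show ?case using Suc by (simp add: algebra_simps)
  qed simp
  define Y where "Y = norm (z 0) + Gb * suminf \<sigma>"
  have s: "(\<Sum>j<k. \<sigma> j) \<le> suminf \<sigma>" for k
    using sigma_summable sigma_pos by (intro sum_le_suminf) (auto intro: less_imp_le)
  have Y: "z k $ i \<le> Y" for k i
    using le[of k i] mult_left_mono[OF s Gb(1), of k] component_le_norm_cart[of "z 0" i]
    unfolding Y_def by linarith
  have Y0: "0 \<le> Y" using Y[of 0] z_nonneg[of 0] order_trans by blast
  define N where "N = real CARD('m) * Y"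
  have N: "norm (z k) \<le> N" for k
  proof -
    have "norm (z k) \<le> (\<Sum>i\<in>UNIV. \<bar>z k $ i\<bar>)" by (rule norm_le_l1_cart)
    also have "\<dots> \<le> (\<Sum>i\<in>(UNIV :: 'm set). Y)" using Y z_nonneg by (intro sum_mono) simp
    finally show ?thesis by (simp add: N_def)
  qed
  have sq: "(norm (zs - z k))\<^sup>2 \<le> (norm zs + N)\<^sup>2" for k
    using norm_triangle_ineq4[of zs "z k"] N[of k] by (intro power_mono) auto
  have N0: "0 \<le> N" using Y0 by (simp add: N_def)
  define W where "W = Y + N + (norm zs + N)\<^sup>2"
  have W: "Y \<le> W" "N \<le> W" "(norm zs + N)\<^sup>2 \<le> W" using Y0 N0 by (auto simp: W_def)
  show ?thesis
  proof (rule that[of W])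
    show "0 \<le> W" using Y0 W(1) by linarith
  qed (use Y N sq W order_trans in \<open>blast+\<close>)
qed

lemma L_pos: "0 < L k"
  unfolding L_Psi_def using Lf_pos lam_pos[of k] Lg_pos
  by (intro add_nonneg_pos sum_nonneg add_nonneg_nonneg mult_nonneg_nonneg) (auto intro: less_imp_le)

lemma L_le_lam:
  obtains K where "0 < K" "\<And>k. L k \<le> K * lam k"
proof -
  obtain Gb where Gb: "0 \<le> Gb" "\<And>y i. y \<in> C \<Longrightarrow> \<bar>g y $ i\<bar> \<le> Gb" by (rule g_bounded) blast
  obtain Z where Z: "0 \<le> Z" "\<And>k i. z k $ i \<le> Z" by (rule z_bounded) blast
  define K where "K = (\<Sum>i\<in>UNIV. (B i)\<^sup>2 + Lg i * (Gb + Z / lam 0)) + Lf / lam 0"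
  \<comment> \<open>As \<open>lam\<close> never drops below \<open>lam 0\<close>, constants are
    absorbed into multiples of \<open>lam k\<close>.\<close>
  have le1: "c \<le> c / lam 0 * lam k" if "0 \<le> c" for c k
    using lam_pos[of 0] mult_left_mono[OF lam_ge[of k] that] by (simp add: field_simps)
  have "L k \<le> K * lam k" for k
  proof -
    have "L_Psi g Lg B (lam k) (x k) (z k) \<le> (\<Sum>i\<in>UNIV. ((B i)\<^sup>2 + Lg i * (Gb + Z / lam 0)) * lam k)"
      unfolding L_Psi_def
    proof (rule sum_mono)
      fix i
      have "lam k * g (x k) $ i \<le> lam k * Gb"
        using Gb(2)[OF x_in, of k i] lam_pos[of k] by (intro mult_left_mono) auto
      moreover have "0 \<le> lam k * Gb" using Gb lam_pos[of k] by simp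
      ultimately have "pos_part (lam k * g (x k) $ i + z k $ i) \<le> (Gb + Z / lam 0) * lam k"
        using Z(2)[of k i] le1[OF Z(1), of k] Z(1)
        unfolding pos_part_def distrib_right mult.commute[of Gb] by linarith
      then have "Lg i * pos_part (lam k * g (x k) $ i + z k $ i) \<le> Lg i * ((Gb + Z / lam 0) * lam k)"
        using Lg_pos[of i] by (intro mult_left_mono) auto
      then show "lam k * (B i)\<^sup>2 + Lg i * pos_part (lam k * g (x k) $ i + z k $ i)
          \<le> ((B i)\<^sup>2 + Lg i * (Gb + Z / lam 0)) * lam k"
        by (simp add: algebra_simps)
    qed
    then show ?thesis
      using le1[of Lf k] Lf_pos by (simp add: K_def distrib_right sum_distrib_right)
  qed
  moreover have "0 < K"
    unfolding K_def using Lg_pos Gb(1) Z(1) lam_pos[of 0] Lf_pos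
    by (intro add_nonneg_pos sum_nonneg) (auto intro!: add_nonneg_nonneg mult_nonneg_nonneg intro: less_imp_le)
  ultimately show ?thesis using that by blast
qed

section \<open>The gap and the change of the suboptimality in one iteration\<close>

definition G :: "nat \<Rightarrow> real" where "G k = u k \<bullet> (x k - v k)"

lemma gap_iterate: "gap f (ind_fun C) g (z k) (lam k) (x k) = ereal (G k)"
  using gap_eq[OF h_proper v_argmin, of k] x_in[of k] v_in[of k]
  by (simp add: ind_fun_def G_def)

text \<open>Convexity at \<open>x k\<close> is tested at \<open>xs\<close>, where the augmented
  Lagrangian is at most \<open>f xs\<close>; then \<open>v k\<close> minimizes the linear form over
  \<open>C\<close>.\<close>

lemma subopt_le_gap: "subopt (lam k) (x k) (z k) \<le> G k"
proof -
  have "F_al f g (lam k) (x k) (z k) + u k \<bullet> (xs - x k) \<le> F_al f g (lam k) xs (z k)"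
    by (rule F_al_tangent_le[OF lam_pos])
  also have "\<dots> \<le> f xs"
    using z_nonneg by (intro F_al_xs_le lam_pos) (simp add: less_eq_vec_def)
  finally have "subopt (lam k) (x k) (z k) \<le> u k \<bullet> x k - u k \<bullet> xs"
    by (simp add: subopt_def inner_diff_right)
  also have "\<dots> \<le> G k" using v_min[OF xs_in, of k] by (simp add: G_def inner_diff_right)
  finally show ?thesis .
qed

lemma gap_nonneg: "0 \<le> G k"
  using v_min[OF x_in, of k k] by (simp add: G_def inner_diff_right)

text \<open>Only the point moves here; the parameters stay at index \<open>k\<close> and are updated
  in \<open>subopt_parameter_change\<close>.\<close>

lemma subopt_step:
  "subopt (lam k) (x (Suc k)) (z k) \<le> subopt (lam k) (x k) (z k)
    - min (G k) ((G k)\<^sup>2 / (L k * (norm (x k - v k))\<^sup>2)) / 2"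
proof -
  have "min (G k) ((G k)\<^sup>2 / (L k * (norm (v k - x k))\<^sup>2)) / 2
      \<le> \<alpha> k * G k - L k / 2 * (\<alpha> k)\<^sup>2 * (norm (v k - x k))\<^sup>2"
    by (rule short_step_decrease[OF gap_nonneg L_pos norm_ge_zero])
      (simp add: alpha short_step_def gap_iterate)
  moreover have "F_al f g (lam k) (x (Suc k)) (z k) \<le> F_al f g (lam k) (x k) (z k)
      + u k \<bullet> (x (Suc k) - x k) + L k / 2 * (norm (x (Suc k) - x k))\<^sup>2"
    by (rule F_al_quadratic_upper[OF lam_pos x_in x_in])
  moreover have "u k \<bullet> (x (Suc k) - x k) = - (\<alpha> k * G k)"
    by (simp add: x_Suc G_def inner_diff_right right_diff_distrib)
  moreover have "L k / 2 * (norm (x (Suc k) - x k))\<^sup>2 = L k / 2 * (\<alpha> k)\<^sup>2 * (norm (v k - x k))\<^sup>2"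
    by (simp add: x_Suc power_mult_distrib)
  ultimately show ?thesis unfolding subopt_def norm_minus_commute[of "x k"] by linarith
qed

text \<open>The constant 4 is the 2 of \<open>al_pen_parameter_change\<close> times the 2 from
  splitting the square of a sum. Separating the squares prepares for
  \<open>infeasibility_square_le\<close>.\<close>

lemma subopt_parameter_change:
  assumes "lam (Suc k) \<le> R * lam k" and Z: "\<And>k i. z k $ i \<le> Z"
  shows "subopt (lam (Suc k)) (x (Suc k)) (z (Suc k)) \<le> subopt (lam k) (x (Suc k)) (z k)
    + 4 * R\<^sup>2 * (lam (Suc k) - lam k + \<sigma> k)
        * ((\<Sum>i\<in>UNIV. (pos_part (g (x (Suc k)) $ i))\<^sup>2) + real CARD('m) * (Z / lam k)\<^sup>2)"
proof -
  let ?c = "2 * R\<^sup>2 * (lam (Suc k) - lam k + \<sigma> k)"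
  have c: "0 \<le> ?c" using lam_less_Suc[of k] sigma_pos[of k] by simp
  have "subopt (lam (Suc k)) (x (Suc k)) (z (Suc k)) - subopt (lam k) (x (Suc k)) (z k)
      = (\<Sum>i\<in>UNIV. al_pen (lam (Suc k)) (z (Suc k) $ i) (g (x (Suc k)) $ i)
          - al_pen (lam k) (z k $ i) (g (x (Suc k)) $ i))"
    by (simp add: subopt_def F_al_eq sum_subtractf)
  also have "\<dots> \<le> (\<Sum>i\<in>UNIV. 2 * ?c * ((pos_part (g (x (Suc k)) $ i))\<^sup>2 + (Z / lam k)\<^sup>2))"
  proof (rule sum_mono)
    fix i
    let ?s = "g (x (Suc k)) $ i"
    have "\<bar>max (- (z k $ i) / lam k) ?s\<bar> \<le> pos_part ?s + z k $ i / lam k"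
    proof -
      have "0 \<le> z k $ i / lam k" using z_nonneg[of k i] lam_pos[of k] by simp
      then show ?thesis by (auto simp: pos_part_def max_def)
    qed
    also have "\<dots> \<le> pos_part ?s + Z / lam k"
      using Z[of k i] lam_pos[of k] by (simp add: divide_right_mono)
    finally have "\<bar>z (Suc k) $ i - z k $ i\<bar> \<le> \<sigma> k * (pos_part ?s + Z / lam k)"
      using sigma_pos[of k] by (simp add: z_Suc abs_mult)
    then have "al_pen (lam (Suc k)) (z (Suc k) $ i) ?s - al_pen (lam k) (z k $ i) ?s
        \<le> ?c * (pos_part ?s + Z / lam k)\<^sup>2"
      using lam_pos lam_less_Suc[of k] sigma_pos[of k] sigma_le[of k] z_nonneg Z assms(1)
      by (intro al_pen_parameter_change) (auto intro: less_imp_le)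
    also have "\<dots> \<le> ?c * (2 * ((pos_part ?s)\<^sup>2 + (Z / lam k)\<^sup>2))"
    proof (rule mult_left_mono[OF _ c])
      have "(a + b)\<^sup>2 \<le> 2 * (a\<^sup>2 + b\<^sup>2)" for a b :: real
        using zero_le_power2[of "a - b"] by (simp add: power2_eq_square algebra_simps)
      then show "(pos_part ?s + Z / lam k)\<^sup>2 \<le> 2 * ((pos_part ?s)\<^sup>2 + (Z / lam k)\<^sup>2)" .
    qed
    finally show "al_pen (lam (Suc k)) (z (Suc k) $ i) ?s - al_pen (lam k) (z k $ i) ?s
        \<le> 2 * ?c * ((pos_part ?s)\<^sup>2 + (Z / lam k)\<^sup>2)" by (simp only: mult_ac)
  qed
  also have "\<dots> = 2 * ?c * ((\<Sum>i\<in>UNIV. (pos_part (g (x (Suc k)) $ i))\<^sup>2) + real CARD('m) * (Z / lam k)\<^sup>2)"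
    by (simp add: sum_distrib_left[symmetric] sum.distrib)
  finally show ?thesis by (simp add: algebra_simps)
qed

end

subsection \<open>Rates\<close>

locale al_fw_run_rates = al_fw_run f C g Lf D Lg B \<nu> q lam \<sigma> \<alpha> x v z xs zs
  for f :: "real^'n \<Rightarrow> real" and C and g :: "real^'n \<Rightarrow> real^'m" and Lf D Lg B
    and \<nu> q lam \<sigma> \<alpha> x v z xs zs +
  fixes \<tau> \<gamma> :: real
  assumes tau: "0 < \<tau>" "\<tau> < 1"
    and lam_rate: "lam \<in> \<Theta>(\<lambda>k. real k powr \<tau>)"
    and lam_diff: "(\<lambda>k. lam (Suc k) - lam k) \<in> O(\<lambda>k. real k powr (-(1 - \<tau>)))"
    and gamma: "0 < \<gamma>"
    and sigma_rate: "\<sigma> \<in> \<Theta>(\<lambda>k. real k powr (-(1 + \<gamma>)))"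
begin

abbreviation "\<delta> k \<equiv> subopt (lam k) (x k) (z k)"

lemma parameter_rates:
  obtains c1 c2 where "0 < c1" "0 < c2"
    "\<forall>\<^sub>F k in sequentially. lam (Suc k) - lam k + \<sigma> k \<le> c1 * real k powr (\<tau> - 1)"
    "\<forall>\<^sub>F k in sequentially. 1 / lam k \<le> c2 * real k powr (-\<tau>)"
    "\<forall>\<^sub>F k in sequentially. lam k \<le> c2 * real k powr \<tau>"
proof -
  obtain a where a: "0 < a" "\<forall>\<^sub>F k in sequentially. norm (lam (Suc k) - lam k) \<le> a * norm (real k powr (-(1 - \<tau>)))"
    using landau_o.bigE[OF lam_diff] by blast
  obtain b where b: "0 < b" "\<forall>\<^sub>F k in sequentially. norm (\<sigma> k) \<le> b * norm (real k powr (-(1 + \<gamma>)))"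
    using landau_o.bigE[OF bigthetaD1[OF sigma_rate]] by blast
  obtain c where c: "0 < c" "\<forall>\<^sub>F k in sequentially. norm (lam k) \<le> c * norm (real k powr \<tau>)"
    using landau_o.bigE[OF bigthetaD1[OF lam_rate]] by blast
  obtain d where d: "0 < d" "\<forall>\<^sub>F k in sequentially. d * norm (real k powr \<tau>) \<le> norm (lam k)"
    using landau_omega.bigE[OF bigthetaD2[OF lam_rate]] by blast
  show ?thesis
  proof (rule that[of "a + b" "max c (1 / d)"])
    show "\<forall>\<^sub>F k in sequentially. lam (Suc k) - lam k + \<sigma> k \<le> (a + b) * real k powr (\<tau> - 1)"
      using a(2) b(2) eventually_ge_at_top[of 1]
    proof eventually_elim
      case (elim k)
      have "real k powr (-(1 + \<gamma>)) \<le> real k powr (\<tau> - 1)"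
        using elim tau gamma by (intro powr_mono) auto
      then have "b * real k powr (-(1 + \<gamma>)) \<le> b * real k powr (\<tau> - 1)" using b by simp
      moreover have "lam (Suc k) - lam k \<le> a * real k powr (\<tau> - 1)"
        "\<sigma> k \<le> b * real k powr (-(1 + \<gamma>))" using elim by auto
      ultimately show ?case unfolding distrib_right by linarith
    qed
    show "\<forall>\<^sub>F k in sequentially. 1 / lam k \<le> max c (1 / d) * real k powr (-\<tau>)"
      using d(2) eventually_ge_at_top[of 1]
    proof eventually_elim
      case (elim k)
      have "1 / lam k \<le> 1 / (d * real k powr \<tau>)"
        using elim d(1) lam_pos[of k] by (intro divide_left_mono) auto
      also have "\<dots> = 1 / d * real k powr (-\<tau>)" by (simp add: powr_minus_divide)
      also have "\<dots> \<le> max c (1 / d) * real k powr (-\<tau>)" by (intro mult_right_mono) auto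
      finally show ?case .
    qed
    show "\<forall>\<^sub>F k in sequentially. lam k \<le> max c (1 / d) * real k powr \<tau>"
      using c(2)
    proof eventually_elim
      case (elim k)
      have "lam k \<le> c * real k powr \<tau>" using elim by simp
      also have "\<dots> \<le> max c (1 / d) * real k powr \<tau>" by (intro mult_right_mono) auto
      finally show ?case .
    qed
  qed (use a b c d in auto)
qed

text \<open>The parameters move by \<open>O(k powr (\<tau> - 1))\<close>, while the squared
  infeasibility carries a factor \<open>1 / lam k = O(k powr (-\<tau>))\<close>. The exponents add
  up to -1.\<close>

lemma perturbation_bound:
  obtains A where "0 \<le> A" "\<forall>\<^sub>F k in sequentially. \<delta> (Suc k) \<le> subopt (lam k) (x (Suc k)) (z k)
    + A / real k * (max 0 (subopt (lam k) (x (Suc k)) (z k)) + real k powr (-\<tau>))"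
proof -
  obtain c1 c2 where c: "0 < c1" "0 < c2"
    and ev1: "\<forall>\<^sub>F k in sequentially. lam (Suc k) - lam k + \<sigma> k \<le> c1 * real k powr (\<tau> - 1)"
    and ev2: "\<forall>\<^sub>F k in sequentially. 1 / lam k \<le> c2 * real k powr (-\<tau>)"
    by (rule parameter_rates) blast
  obtain Z where Z: "0 \<le> Z" "\<And>k i. z k $ i \<le> Z" "\<And>k. (norm (zs - z k))\<^sup>2 \<le> Z"
    by (rule z_bounded) blast
  \<comment> \<open>\<open>R\<close> bounds the ratio of consecutive penalty parameters: their
    increments are at most \<open>c1\<close> because \<tau> < 1, and \<open>lam k\<close> is at
    least \<open>lam 0\<close>.\<close>
  define R where "R = 1 + c1 / lam 0"
  define K where "K = 4 + (4 * Z + real CARD('m) * Z\<^sup>2) * c2"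
  define A where "A = 4 * R\<^sup>2 * c1 * c2 * K"
  have K: "4 \<le> K" "0 \<le> K" using Z c by (auto simp: K_def)
  have "\<forall>\<^sub>F k in sequentially. \<delta> (Suc k) \<le> subopt (lam k) (x (Suc k)) (z k)
    + A / real k * (max 0 (subopt (lam k) (x (Suc k)) (z k)) + real k powr (-\<tau>))"
    using ev1 ev2 eventually_ge_at_top[of 1]
  proof eventually_elim
    case (elim k)
    let ?d = "subopt (lam k) (x (Suc k)) (z k)"
    let ?l = "lam k"
    have l: "0 < ?l" by (rule lam_pos)
    have "real k powr (\<tau> - 1) \<le> real k powr 0" using elim tau by (intro powr_mono) auto
    then have "c1 * real k powr (\<tau> - 1) \<le> c1 * 1" using c elim by (intro mult_left_mono) auto
    moreover have "c1 \<le> c1 / lam 0 * ?l"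
      using lam_ge[of k] lam_pos[of 0] c by (simp add: pos_le_divide_eq)
    ultimately have R: "lam (Suc k) \<le> R * ?l"
      using elim(1) sigma_pos[of k] by (simp add: R_def distrib_right)
    let ?S = "(\<Sum>i\<in>UNIV. (pos_part (g (x (Suc k)) $ i))\<^sup>2)"
    have "?l / 4 * ?S \<le> max 0 ?d + Z / ?l"
      using infeasibility_square_le[OF l x_in[of "Suc k"], of "z k"]
        divide_right_mono[OF Z(3)[of k], of ?l] l by linarith
    then have S: "?S \<le> 4 * (max 0 ?d + Z / ?l) / ?l"
      using l by (simp add: pos_le_divide_eq mult.commute)
    have "?S + real CARD('m) * (Z / ?l)\<^sup>2
        \<le> (1 / ?l) * (4 * max 0 ?d + (4 * Z + real CARD('m) * Z\<^sup>2) * (1 / ?l))"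
    proof -
      have "4 * (max 0 ?d + Z / ?l) / ?l + real CARD('m) * (Z / ?l)\<^sup>2
          = (1 / ?l) * (4 * max 0 ?d + (4 * Z + real CARD('m) * Z\<^sup>2 ) * (1 / ?l))"
        using l by (simp add: field_simps power2_eq_square)
      then show ?thesis using S by linarith
    qed
    also have "\<dots> \<le> (c2 * real k powr (-\<tau>)) * (4 * max 0 ?d + (4 * Z + real CARD('m) * Z\<^sup>2) * (c2 * real k powr (-\<tau>)))"
      using elim(2) l c Z by (intro mult_mono add_mono order_refl mult_left_mono) auto
    also have "\<dots> \<le> (c2 * real k powr (-\<tau>)) * (K * (max 0 ?d + real k powr (-\<tau>)))"
    proof (intro mult_left_mono)
      have "4 * max 0 ?d \<le> K * max 0 ?d" using K by (intro mult_right_mono) auto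
      moreover have "(4 * Z + real CARD('m) * Z\<^sup>2) * c2 * real k powr (-\<tau>) \<le> K * real k powr (-\<tau>)"
        by (intro mult_right_mono) (auto simp: K_def)
      ultimately show "4 * max 0 ?d + (4 * Z + real CARD('m) * Z\<^sup>2) * (c2 * real k powr (-\<tau>))
          \<le> K * (max 0 ?d + real k powr (-\<tau>))"
        unfolding distrib_left by (simp only: mult.assoc)
    qed (use c in auto)
    finally have S2: "?S + real CARD('m) * (Z / ?l)\<^sup>2
        \<le> (c2 * real k powr (-\<tau>)) * (K * (max 0 ?d + real k powr (-\<tau>)))" .
    have "\<delta> (Suc k) \<le> ?d + 4 * R\<^sup>2 * (lam (Suc k) - ?l + \<sigma> k) * (?S + real CARD('m) * (Z / ?l)\<^sup>2)"
      by (rule subopt_parameter_change[OF R Z(2)])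
    also have "\<dots> \<le> ?d + 4 * R\<^sup>2 * (c1 * real k powr (\<tau> - 1))
        * ((c2 * real k powr (-\<tau>)) * (K * (max 0 ?d + real k powr (-\<tau>))))"
      using S2 elim(1) c K lam_less_Suc[of k] sigma_pos[of k]
      by (intro add_mono mult_mono order_refl mult_left_mono)
        (auto intro!: add_nonneg_nonneg sum_nonneg mult_nonneg_nonneg)
    also have "\<dots> = ?d + A * (real k powr (\<tau> - 1) * real k powr (-\<tau>)) * (max 0 ?d + real k powr (-\<tau>))"
      by (simp add: A_def mult_ac)
    also have "real k powr (\<tau> - 1) * real k powr (-\<tau>) = 1 / real k"
      using elim by (subst powr_add[symmetric]) (simp add: powr_minus_divide)
    finally show ?case by simp
  qed
  moreover have "0 \<le> A" using c K by (simp add: A_def)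
  ultimately show ?thesis using that by blast
qed

text \<open>Any lower bound on the progress of order \<open>\<delta> powr (1 + \<mu>) / lam\<close>
  feeds \<open>perturbed_descent_rate\<close>. Stating it for general \<mu> allows both uses, with
  the diameter bound and with uniform convexity.\<close>

lemma subopt_rate:
  assumes c: "0 < c" and mu: "0 \<le> \<mu>" and rho: "0 < \<rho>" "\<rho> \<le> \<tau>" "\<mu> * \<rho> \<le> 1 - \<tau>"
    and progress: "\<forall>\<^sub>F k in sequentially. 0 < \<delta> k \<longrightarrow>
      c * \<delta> k powr (1 + \<mu>) / lam k \<le> (G k)\<^sup>2 / (L k * (norm (x k - v k))\<^sup>2)"
  shows "(\<lambda>k. max 0 (\<delta> k)) \<in> O(\<lambda>k. real k powr (-\<rho>))"
proof -
  obtain A where A: "0 \<le> A" and evA: "\<forall>\<^sub>F k in sequentially. \<delta> (Suc k) \<le> subopt (lam k) (x (Suc k)) (z k)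
    + A / real k * (max 0 (subopt (lam k) (x (Suc k)) (z k)) + real k powr (-\<tau>))"
    by (rule perturbation_bound) blast
  obtain c2 where c2: "0 < c2" "\<forall>\<^sub>F k in sequentially. 1 / lam k \<le> c2 * real k powr (-\<tau>)"
     "\<forall>\<^sub>F k in sequentially. lam k \<le> c2 * real k powr \<tau>"
    by (rule parameter_rates) blast
  \<comment> \<open>The 2 is the halving in the step estimate, and \<open>c2\<close> replaces
    \<open>lam k\<close> by a power of \<open>k\<close>.\<close>
  let ?c = "c / (2 * c2)"
  have "\<forall>\<^sub>F k in sequentially. max 0 (\<delta> (Suc k)) \<le> max 0 (\<delta> k)
        - min (max 0 (\<delta> k) / 2) (?c * max 0 (\<delta> k) powr (1 + \<mu>) * real k powr (-\<tau>))
        + A / real k * (max 0 (\<delta> k) + real k powr (-\<tau>))"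
    using evA c2(3) progress eventually_ge_at_top[of 1]
  proof eventually_elim
    case (elim k)
    let ?d = "subopt (lam k) (x (Suc k)) (z k)"
    have step: "?d \<le> \<delta> k - min (G k) ((G k)\<^sup>2 / (L k * (norm (x k - v k))\<^sup>2)) / 2"
      by (rule subopt_step)
    have "0 \<le> min (G k) ((G k)\<^sup>2 / (L k * (norm (x k - v k))\<^sup>2)) / 2"
      using gap_nonneg[of k] L_pos[of k] by (simp add: less_imp_le)
    then have dd: "?d \<le> \<delta> k" using step by linarith
    have "A / real k * (max 0 ?d + real k powr (-\<tau>)) \<le> A / real k * (max 0 (\<delta> k) + real k powr (-\<tau>))"
      using dd A by (intro mult_left_mono) auto
    then have main: "\<delta> (Suc k) \<le> ?d + A / real k * (max 0 (\<delta> k) + real k powr (-\<tau>))"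
      using elim(1) by linarith
    have pert: "0 \<le> A / real k * (max 0 (\<delta> k) + real k powr (-\<tau>))"
      using A by (intro mult_nonneg_nonneg add_nonneg_nonneg) auto
    show ?case
    proof (cases "0 < \<delta> k")
      case True
      have "?c * \<delta> k powr (1 + \<mu>) * real k powr (-\<tau>) = c * \<delta> k powr (1 + \<mu>) / (c2 * real k powr \<tau>) / 2"
        by (simp add: powr_minus_divide)
      also have "\<dots> \<le> c * \<delta> k powr (1 + \<mu>) / lam k / 2"
        using elim(2,4) c c2(1) lam_pos[of k] by (intro divide_right_mono divide_left_mono) auto
      also have "\<dots> \<le> (G k)\<^sup>2 / (L k * (norm (x k - v k))\<^sup>2) / 2"
        using elim(3) True by (intro divide_right_mono) auto
      finally have le: "?c * \<delta> k powr (1 + \<mu>) * real k powr (-\<tau>)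
          \<le> (G k)\<^sup>2 / (L k * (norm (x k - v k))\<^sup>2) / 2" .
      define m where "m = min (\<delta> k / 2) (?c * \<delta> k powr (1 + \<mu>) * real k powr (-\<tau>))"
      define Q where "Q = (G k)\<^sup>2 / (L k * (norm (x k - v k))\<^sup>2)"
      have m_le: "m \<le> \<delta> k / 2" by (simp add: m_def)
      then have "m \<le> G k / 2" using subopt_le_gap[of k] by linarith
      moreover have "m \<le> Q / 2" unfolding m_def Q_def using le by (rule min.coboundedI2)
      ultimately have 1: "?d \<le> \<delta> k - m" using step unfolding Q_def[symmetric] by linarith
      have 2: "0 \<le> \<delta> k - m" using True m_le by linarith
      have m0: "max 0 (\<delta> k) = \<delta> k" using True by simp
      show ?thesis
        using main pert 1 2 unfolding m0 m_def[symmetric] by linarith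
    next
      \<comment> \<open>The truncated suboptimality is 0 here, so only the perturbation can make the
        next one positive.\<close>
      case False
      then have "max 0 (\<delta> k) = 0" by simp
      then show ?thesis using main pert dd False by simp
    qed
  qed
  then show ?thesis
    by (rule perturbed_descent_rate[rotated]) (use c c2 A mu tau rho in auto)
qed

end

section \<open>From convergence to the improved rate\<close>

context al_fw_run_rates
begin

text \<open>\<open>subopt_rate\<close> with exponent 1 in place of \<mu>, where the distance to
  \<open>v k\<close> is merely bounded by \<open>D\<close>. The rate matters only as a proof of
  convergence to 0.\<close>

lemma subopt_rate_bounded_domain:
  "(\<lambda>k. max 0 (\<delta> k)) \<in> O(\<lambda>k. real k powr (- min \<tau> (1 - \<tau>)))"
proof -
  obtain K where K: "0 < K" "\<And>k. L k \<le> K * lam k" by (rule L_le_lam) blast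
  have "1 / (K * D\<^sup>2) * \<delta> k powr (1 + 1) / lam k \<le> (G k)\<^sup>2 / (L k * (norm (x k - v k))\<^sup>2)"
    if pos: "0 < \<delta> k" for k
  proof -
    have G: "\<delta> k \<le> G k" by (rule subopt_le_gap)
    then have "x k \<noteq> v k" using pos by (auto simp: G_def)
    then have d: "0 < norm (x k - v k)" by simp
    have dD: "norm (x k - v k) \<le> D" using dom_bound[of "x k" "v k"] x_in v_in by simp
    have "1 / (K * D\<^sup>2) * \<delta> k powr (1 + 1) / lam k = (\<delta> k)\<^sup>2 / (K * lam k * D\<^sup>2)"
      using pos by (simp add: powr_numeral mult_ac)
    also have "\<dots> \<le> (G k)\<^sup>2 / (L k * (norm (x k - v k))\<^sup>2)"
      using G pos L_pos[of k] K d dD lam_pos[of k]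
      by (intro frac_le power_mono mult_mono mult_pos_pos) (auto intro: less_imp_le)
    finally show ?thesis .
  qed
  then have "\<forall>\<^sub>F k in sequentially. 0 < \<delta> k \<longrightarrow> 1 / (K * D\<^sup>2) * \<delta> k powr (1 + 1) / lam k
      \<le> (G k)\<^sup>2 / (L k * (norm (x k - v k))\<^sup>2)" by simp
  then show ?thesis
    by (rule subopt_rate[rotated 5]) (use K D_pos tau in auto)
qed

text \<open>Vanishing truncated suboptimality forces near feasibility. For a constraint below
  \<open>- \<epsilon>\<close>, the growing \<open>lam k\<close> eventually outweighs the bounded
  multiplier, so the projection returns 0.\<close>

lemma eventually_near_active:
  assumes eps: "0 < \<epsilon>"
  shows "\<forall>\<^sub>F k in sequentially. (x k, \<chi> i. new_mult (lam k) (x k) (z k) i) \<in> near_active g \<epsilon>"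
proof -
  obtain Z where Z: "0 \<le> Z" "\<And>k i. z k $ i \<le> Z" "\<And>k. (norm (zs - z k))\<^sup>2 \<le> Z"
    by (rule z_bounded) blast
  obtain c where c: "\<forall>\<^sub>F k in sequentially. norm (max 0 (\<delta> k)) \<le> c * norm (real k powr (- min \<tau> (1 - \<tau>)))"
    using landau_o.bigE[OF subopt_rate_bounded_domain] by blast
  have "((\<lambda>k. real k powr (- min \<tau> (1 - \<tau>))) \<longlongrightarrow> 0) sequentially"
    using tau by (intro tendsto_neg_powr filterlim_real_sequentially) auto
  then have lim1: "((\<lambda>k. max 0 (\<delta> k)) \<longlongrightarrow> 0) sequentially"
    by (rule tendsto_0_le[where K = c]) (use c in \<open>simp only: mult.commute[of c]\<close>)
  have lim2: "((\<lambda>k. (Z + real CARD('m)) / lam k) \<longlongrightarrow> 0) sequentially"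
    by (rule tendsto_divide_0[OF tendsto_const filterlim_at_top_imp_at_infinity[OF lam_at_top]])
  have "((\<lambda>k. max 0 (\<delta> k) + (Z + real CARD('m)) / lam k) \<longlongrightarrow> 0) sequentially"
    using tendsto_add[OF lim1 lim2] by simp
  then have "\<forall>\<^sub>F k in sequentially. max 0 (\<delta> k) + (Z + real CARD('m)) / lam k < \<epsilon>"
    by (rule order_tendstoD) (rule eps)
  moreover have "\<forall>\<^sub>F k in sequentially. Z / \<epsilon> \<le> lam k"
    using lam_at_top by (simp add: filterlim_at_top)
  ultimately show ?thesis
  proof eventually_elim
    case (elim k)
    have "g (x k) $ i \<le> \<epsilon>" for i
    proof -
      have "g (x k) $ i \<le> pos_part (g (x k) $ i)" by (rule pos_part_ge)
      also have "\<dots> \<le> (\<Sum>i\<in>UNIV. pos_part (g (x k) $ i))" by (rule member_le_sum) auto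
      also have "\<dots> \<le> \<delta> k + ((norm (zs - z k))\<^sup>2 + real CARD('m)) / lam k"
        by (rule infeasibility_le[OF lam_pos x_in])
      also have "\<dots> \<le> max 0 (\<delta> k) + (Z + real CARD('m)) / lam k"
        using Z(3)[of k] lam_pos[of k] by (intro add_mono divide_right_mono) auto
      also have "\<dots> \<le> \<epsilon>" using elim(1) by simp
      finally show ?thesis .
    qed
    moreover have "new_mult (lam k) (x k) (z k) i = 0" if "g (x k) $ i < - \<epsilon>" for i
    proof -
      have "lam k * g (x k) $ i \<le> lam k * (- \<epsilon>)"
        using that lam_pos[of k] by (intro mult_left_mono) auto
      moreover have "Z \<le> lam k * \<epsilon>" using elim(2) eps by (simp add: divide_le_eq)
      ultimately have "lam k * g (x k) $ i + z k $ i \<le> 0" using Z(2)[of k i] by simp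
      then show ?thesis by (simp add: pos_part_def)
    qed
    ultimately show ?case by (simp add: near_active_def less_eq_vec_def)
  qed
qed

text \<open>Linear growth gives \<open>\<kappa> * d powr q \<le> G\<close> for the distance
  \<open>d\<close> to \<open>v k\<close>, hence
  \<open>d\<^sup>2 \<le> (G / \<kappa>) powr (2 / q)\<close>. Dividing \<open>G\<^sup>2\<close> by
  this leaves the exponent \<open>2 - 2 / q = 1 + \<mu>\<close>.\<close>

lemma progress_uniformly_convex:
  assumes \<eta>: "0 < \<eta>" and u: "\<forall>\<^sub>F k in sequentially. \<eta> \<le> norm (u k)" and mu: "\<mu> = 1 - 2 / q"
  obtains c where "0 < c" "\<forall>\<^sub>F k in sequentially. 0 < \<delta> k \<longrightarrow>
    c * \<delta> k powr (1 + \<mu>) / lam k \<le> (G k)\<^sup>2 / (L k * (norm (x k - v k))\<^sup>2)"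
proof -
  obtain K where K: "0 < K" "\<And>k. L k \<le> K * lam k" by (rule L_le_lam) blast
  define \<kappa> where "\<kappa> = \<nu> / 2 * \<eta>"
  have \<kappa>: "0 < \<kappa>" using nu_pos \<eta> by (simp add: \<kappa>_def)
  have "2 / q \<le> 1" using q_ge by simp
  then have q: "0 < q" "0 \<le> 1 + \<mu>" using q_ge mu by linarith+
  have "\<forall>\<^sub>F k in sequentially. 0 < \<delta> k \<longrightarrow>
    \<kappa> powr (2 / q) / K * \<delta> k powr (1 + \<mu>) / lam k \<le> (G k)\<^sup>2 / (L k * (norm (x k - v k))\<^sup>2)"
    using u
  proof eventually_elim
    case (elim k)
    show ?case
    proof
      assume pos: "0 < \<delta> k"
      have G: "\<delta> k \<le> G k" by (rule subopt_le_gap)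
      then have G0: "0 < G k" using pos by simp
      then have "x k \<noteq> v k" by (auto simp: G_def)
      then have d: "0 < norm (x k - v k)" by simp
      have "\<kappa> * norm (x k - v k) powr q \<le> \<nu> / 2 * norm (u k) * norm (x k - v k) powr q"
        unfolding \<kappa>_def using elim nu_pos by (intro mult_right_mono mult_left_mono) auto
      also have "\<dots> \<le> G k"
        unfolding G_def by (rule uniformly_convex_linear_growth[OF C_unif v_in v_min x_in])
      finally have "norm (x k - v k) powr q \<le> G k / \<kappa>" using \<kappa> by (simp add: field_simps)
      then have "(norm (x k - v k) powr q) powr (2 / q) \<le> (G k / \<kappa>) powr (2 / q)"
        using q by (intro powr_mono2) auto
      then have dG: "(norm (x k - v k))\<^sup>2 \<le> (G k / \<kappa>) powr (2 / q)"
        using q d by (simp add: powr_powr powr_numeral)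
      have "\<kappa> powr (2 / q) / K * \<delta> k powr (1 + \<mu>) / lam k
          \<le> \<kappa> powr (2 / q) / K * G k powr (1 + \<mu>) / lam k"
        using K(1) lam_pos[of k] G pos q
        by (intro divide_right_mono mult_left_mono powr_mono2) (auto intro: less_imp_le)
      also have "\<dots> = (G k)\<^sup>2 / (K * lam k * (G k / \<kappa>) powr (2 / q))"
      proof -
        have "G k powr (1 + \<mu>) * G k powr (2 / q) = G k powr 2"
          unfolding mu by (subst powr_add[symmetric]) simp
        then have "G k powr (1 + \<mu>) * G k powr (2 / q) = (G k)\<^sup>2" using G0 by (simp add: powr_numeral)
        then show ?thesis using G0 \<kappa> K lam_pos[of k] by (simp add: powr_divide field_simps)
      qed
      also have "\<dots> \<le> (G k)\<^sup>2 / (L k * (norm (x k - v k))\<^sup>2)"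
        using L_pos[of k] K d dG G0 lam_pos[of k]
        by (intro divide_left_mono mult_mono mult_pos_pos) (auto intro: less_imp_le)
      finally show "\<kappa> powr (2 / q) / K * \<delta> k powr (1 + \<mu>) / lam k
          \<le> (G k)\<^sup>2 / (L k * (norm (x k - v k))\<^sup>2)" .
    qed
  qed
  moreover have "0 < \<kappa> powr (2 / q) / K" using \<kappa> K by simp
  ultimately show ?thesis using that by blast
qed

text \<open>The gradient of the augmented Lagrangian is a Lagrangian gradient at a near active pair,
  so it is eventually at least \<eta>. The residual adds only a multiple of
  \<open>1 / lam k\<close>, which \<rho> \<le> \<tau> absorbs.\<close>

lemma residual_rate:
  assumes "0 < \<epsilon>" "0 < \<eta>"
    and grad_ge: "\<And>y w. (y, w) \<in> near_active g \<epsilon> \<Longrightarrow> y \<in> C \<Longrightarrow>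
      \<eta> \<le> norm (grad f y + (\<Sum>i\<in>UNIV. w $ i *\<^sub>R grad (\<lambda>y. g y $ i) y))"
    and mu: "\<mu> = 1 - 2 / q"
    and rho: "0 < \<rho>" "\<rho> \<le> \<tau>" "\<mu> * \<rho> \<le> 1 - \<tau>"
  shows "(\<lambda>k. residual f (ind_fun C) g (x k)) \<in> O(\<lambda>k. real k powr (-\<rho>))"
proof -
  have "\<forall>\<^sub>F k in sequentially. \<eta> \<le> norm (u k)"
    using eventually_near_active[OF assms(1)]
  proof eventually_elim
    case (elim k)
    then show ?case using grad_ge[OF elim x_in] by (simp add: grad_F_eq[OF lam_pos])
  qed
  then obtain c where c: "0 < c" "\<forall>\<^sub>F k in sequentially. 0 < \<delta> k \<longrightarrow>
    c * \<delta> k powr (1 + \<mu>) / lam k \<le> (G k)\<^sup>2 / (L k * (norm (x k - v k))\<^sup>2)"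
    using progress_uniformly_convex[OF assms(2) _ mu] by blast
  have "0 \<le> \<mu>" using mu q_ge by simp
  then have sub: "(\<lambda>k. max 0 (\<delta> k)) \<in> O(\<lambda>k. real k powr (-\<rho>))"
    by (intro subopt_rate[OF c(1) _ rho c(2)])
  obtain c2 where c2: "0 < c2" "\<forall>\<^sub>F k in sequentially. 1 / lam k \<le> c2 * real k powr (-\<tau>)"
    by (rule parameter_rates) blast
  have "(\<lambda>k. 1 / lam k) \<in> O(\<lambda>k. real k powr (-\<rho>))"
  proof (rule bigoI[of _ c2])
    show "\<forall>\<^sub>F k in sequentially. norm (1 / lam k) \<le> c2 * norm (real k powr (-\<rho>))"
      using c2(2) eventually_ge_at_top[of 1]
    proof eventually_elim
      case (elim k)
      have "c2 * real k powr (-\<tau>) \<le> c2 * real k powr (-\<rho>)"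
        using elim c2(1) rho by (intro mult_left_mono powr_mono) auto
      then show ?case using elim lam_pos[of k] by simp
    qed
  qed
  obtain Z where Z: "0 \<le> Z" "\<And>k. norm (z k) \<le> Z" "\<And>k. (norm (zs - z k))\<^sup>2 \<le> Z"
    by (rule z_bounded) blast
  define W where "W = Z + Z\<^sup>2 + real CARD('m)"
  have zs1: "1 + norm zs \<noteq> 0" using norm_ge_zero[of zs] by linarith
  have "0 < real CARD('m)" by simp
  then have W0: "W \<noteq> 0" using Z(1) zero_le_power2[of Z] unfolding W_def by linarith
  have "(\<lambda>k. W * (1 / lam k)) \<in> O(\<lambda>k. real k powr (-\<rho>))"
    using \<open>(\<lambda>k. 1 / lam k) \<in> O(\<lambda>k. real k powr (-\<rho>))\<close> W0
    by (subst landau_o.big.cmult_in_iff)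
  then have "(\<lambda>k. max 0 (\<delta> k) + W * (1 / lam k)) \<in> O(\<lambda>k. real k powr (-\<rho>))"
    by (rule sum_in_bigo(1)[OF sub])
  then have "(\<lambda>k. (1 + norm zs) * (max 0 (\<delta> k) + W * (1 / lam k))) \<in> O(\<lambda>k. real k powr (-\<rho>))"
    using zs1 by (subst landau_o.big.cmult_in_iff)
  moreover have "(\<lambda>k. residual f (ind_fun C) g (x k)) \<in>
      O(\<lambda>k. (1 + norm zs) * (max 0 (\<delta> k) + W * (1 / lam k)))"
  proof (intro bigoI[of _ 1] always_eventually allI)
    fix k
    have "0 \<le> residual f (ind_fun C) g (x k)"
      unfolding residual_def by (rule max.coboundedI2) simp
    moreover have "residual f (ind_fun C) g (x k) \<le> (1 + norm zs) *
        (max 0 (\<delta> k) + ((norm (zs - z k))\<^sup>2 + (norm (z k))\<^sup>2 + real CARD('m)) / lam k)"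
      by (rule residual_le[OF lam_pos x_in])
    moreover have "\<dots> \<le> (1 + norm zs) * (max 0 (\<delta> k) + W / lam k)"
      unfolding W_def using Z lam_pos[of k]
      by (intro mult_left_mono add_mono divide_right_mono power_mono) (auto intro: less_imp_le)
    ultimately show "norm (residual f (ind_fun C) g (x k))
        \<le> 1 * norm ((1 + norm zs) * (max 0 (\<delta> k) + W * (1 / lam k)))"
      by simp
  qed
  ultimately show ?thesis by (rule landau_o.big_trans[rotated])
qed

end

theorem mainTheorem6:
  fixes f :: "real^'n \<Rightarrow> real" and h :: "real^'n \<Rightarrow> ereal" and g :: "real^'n \<Rightarrow> real^'m"
    and Lf D :: real and Lg B :: "'m \<Rightarrow> real"
    and C :: "(real^'n) set" and \<nu> q \<mu> \<epsilon> \<tau> \<gamma> :: real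
    and lam \<sigma> \<alpha> :: "nat \<Rightarrow> real"
    and x v :: "nat \<Rightarrow> real^'n" and z :: "nat \<Rightarrow> real^'m"
  assumes program: "convex_program f h g Lf D Lg B"
    and h_ind: "h = ind_fun C"
    and C_compact: "compact C"
    and C_unif: "uniformly_convex_set \<nu> q C"
    and eps_pos: "0 < \<epsilon>"
    and grad_bound: "0 < (INF (y, w)\<in>{(y, w). (y, w) \<in> near_active g \<epsilon> \<and> y \<in> C}.
      ereal (norm (grad f y + (\<Sum>i\<in>UNIV. w $ i *\<^sub>R grad (\<lambda>y'. g y' $ i) y))))"
    and run: "al_fw_sequence f h g lam \<sigma> \<alpha> x z v"
    and tau: "0 < \<tau>" "\<tau> < 1"
    and lam_rate: "lam \<in> \<Theta>(\<lambda>k. real k powr \<tau>)"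
    and lam_diff: "(\<lambda>k. lam (Suc k) - lam k) \<in> O(\<lambda>k. real k powr (-(1 - \<tau>)))"
    and alpha: "\<And>k. \<alpha> k = short_step f h g Lf Lg B (x k) (z k) (v k) (lam k)"
    and gamma: "0 < \<gamma>"
    and sigma_rate: "\<sigma> \<in> \<Theta>(\<lambda>k. real k powr (-(1 + \<gamma>)))"
    and mu: "\<mu> = 1 - 2 / q"
  shows "(\<lambda>k. residual f h g (x k)) \<in>
           O(\<lambda>k. max (1 / real k powr (1 / (1 + \<mu>)))
                  (max (1 / real k powr ((2 - 2 * \<tau>) / (1 + \<mu>))) (1 / real k powr \<tau>))) \<and>
         (q = 2 \<and> \<tau> = 2 / 3 \<longrightarrow>
           (\<lambda>k. residual f h g (x k)) \<in> O(\<lambda>k. 1 / real k powr (2 / 3)))"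
proof -
  interpret prog: convex_program f "ind_fun C" g Lf D Lg B using program h_ind by simp
  have "C \<noteq> {}" using run h_ind by (auto simp: al_fw_sequence_def)
  then obtain xs zs where saddle: "xs \<in> C" "g xs \<le> 0" "0 \<le> zs"
    "\<And>y. y \<in> C \<Longrightarrow> f xs \<le> f y + zs \<bullet> g y"
    using kkt_saddle[OF prog.convex_program_axioms] by blast
  interpret al_fw_run_rates f C g Lf D Lg B \<nu> q lam \<sigma> \<alpha> x v z xs zs \<tau> \<gamma>
    using saddle C_compact C_unif run alpha h_ind tau lam_rate lam_diff gamma sigma_rate
    by unfold_locales auto
  define I where "I = (INF (y, w)\<in>{(y, w). (y, w) \<in> near_active g \<epsilon> \<and> y \<in> C}.
      ereal (norm (grad f y + (\<Sum>i\<in>UNIV. w $ i *\<^sub>R grad (\<lambda>y'. g y' $ i) y))))"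
  \<comment> \<open>The infimum may be infinite, when it ranges over the empty set, so a real bound
    is taken strictly below it.\<close>
  obtain e where e: "0 < e" "e < I" using dense[OF grad_bound[folded I_def]] by blast
  have "e < \<infinity>" using less_le_trans[OF e(2) top_greatest] by (simp only: top_ereal_def)
  then obtain \<eta> where \<eta>: "e = ereal \<eta>" "0 < \<eta>" using e(1) by (cases e) auto
  have grad_ge: "\<eta> \<le> norm (grad f y + (\<Sum>i\<in>UNIV. w $ i *\<^sub>R grad (\<lambda>y. g y $ i) y))"
    if "(y, w) \<in> near_active g \<epsilon>" "y \<in> C" for y w
  proof -
    have "I \<le> ereal (norm (grad f y + (\<Sum>i\<in>UNIV. w $ i *\<^sub>R grad (\<lambda>y. g y $ i) y)))"
      unfolding I_def by (rule INF_lower2[of "(y, w)"]) (use that in auto)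
    then have "ereal \<eta> \<le> ereal (norm (grad f y + (\<Sum>i\<in>UNIV. w $ i *\<^sub>R grad (\<lambda>y. g y $ i) y)))"
      using e(2) unfolding \<eta>(1) by (rule order_trans[OF less_imp_le, rotated])
    then show ?thesis by simp
  qed
  \<comment> \<open>The slowest of the three powers in the claim has the smallest exponent.\<close>
  define \<rho> where "\<rho> = min (1 / (1 + \<mu>)) (min ((2 - 2 * \<tau>) / (1 + \<mu>)) \<tau>)"
  have "0 < 2 / q" "2 / q \<le> 1" using q_ge by simp_all
  then have mu01: "0 \<le> \<mu>" "\<mu> < 1" using mu by linarith+
  then have rho: "0 < \<rho>" "\<rho> \<le> \<tau>" using tau by (simp_all add: \<rho>_def)
  have "\<mu> * \<rho> \<le> 1 - \<tau>"
  proof -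
    have "(1 + \<mu>) * \<rho> \<le> 2 - 2 * \<tau>"
    proof -
      have "\<rho> \<le> (2 - 2 * \<tau>) / (1 + \<mu>)" by (simp add: \<rho>_def)
      then show ?thesis using mu01 by (simp add: field_simps)
    qed
    \<comment> \<open>With \<mu> < 1 the bound on \<open>(1 + \<mu>) * \<rho>\<close> becomes one on
      \<open>2 * \<mu> * \<rho>\<close>, and halving gives the condition of the recursion.\<close>
    moreover have "2 * \<mu> * \<rho> \<le> (1 + \<mu>) * \<rho>" using mu01 rho by (intro mult_right_mono) auto
    ultimately show ?thesis by simp
  qed
  from residual_rate[OF eps_pos \<eta>(2) grad_ge mu rho this]
  have res: "(\<lambda>k. residual f h g (x k)) \<in> O(\<lambda>k. real k powr (-\<rho>))" by (simp add: h_ind)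
  have "(\<lambda>k. real k powr (-\<rho>)) \<in> O(\<lambda>k. max (1 / real k powr (1 / (1 + \<mu>)))
                  (max (1 / real k powr ((2 - 2 * \<tau>) / (1 + \<mu>))) (1 / real k powr \<tau>)))"
  proof (intro bigoI[of _ 1] always_eventually allI)
    fix k
    define s where "s r = 1 / real k powr r" for r
    \<comment> \<open>Identifying \<rho> with one of the three exponents avoids monotonicity of
      powers and therefore also covers \<open>k = 0\<close>.\<close>
    have "\<rho> = 1 / (1 + \<mu>) \<or> \<rho> = (2 - 2 * \<tau>) / (1 + \<mu>) \<or> \<rho> = \<tau>"
      unfolding \<rho>_def min_def by presburger
    then have "s \<rho> \<le> max (s (1 / (1 + \<mu>))) (max (s ((2 - 2 * \<tau>) / (1 + \<mu>))) (s \<tau>))"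
      by (elim disjE) (simp_all only: max.cobounded1 max.cobounded2 max.coboundedI2)
    then show "norm (real k powr (-\<rho>)) \<le> 1 * norm (max (1 / real k powr (1 / (1 + \<mu>)))
        (max (1 / real k powr ((2 - 2 * \<tau>) / (1 + \<mu>))) (1 / real k powr \<tau>)))"
      by (simp add: s_def powr_minus_divide)
  qed
  then have main: "(\<lambda>k. residual f h g (x k)) \<in> O(\<lambda>k. max (1 / real k powr (1 / (1 + \<mu>)))
                  (max (1 / real k powr ((2 - 2 * \<tau>) / (1 + \<mu>))) (1 / real k powr \<tau>)))"
    by (rule landau_o.big_trans[OF res])
  moreover have "(\<lambda>k. residual f h g (x k)) \<in> O(\<lambda>k. 1 / real k powr (2 / 3))" if "q = 2" "\<tau> = 2 / 3"
  proof -
    \<comment> \<open>The three exponents are 1, 2/3 and 2/3.\<close>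
    have rho_eq: "\<rho> = 2 / 3" using that mu by (simp add: \<rho>_def)
    show ?thesis using res unfolding rho_eq by (simp add: powr_minus_divide)
  qed
  ultimately show ?thesis by blast
qed

end
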